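(* Let $P,Q:\mathbb{R}^2\to\mathbb{R}$ be continuously differentiable functions such that the planar system $$\dot x = P(x,y),\qquad \dot y = Q(x,y)$$ has existence and uniqueness of solutions, and assume that the origin is its unique equilibrium point. Write $V(x,y)=(P(x,y),Q(x,y))$ and define $$\alpha(x,y)=P(x,y)\bigl(xQ_x(x,y)+yQ_y(x,y)\bigr)-Q(x,y)\bigl(xP_x(x,y)+yP_y(x,y)\bigr).$$ Assume $\alpha(x,y)\ge 0$ for all $(x,y)\in\mathbb{R}^2$. Suppose that at least one of the following conditions holds: (1) for every $(x,y)\in\mathbb{R}^2\setminus\{(0,0)\}$ and every $\tau>0$, the vectors $V(\tau x,\tau y)$ and $V(x,y)$ are linearly independent; (2) there exist an interval $(a,b)$ (possibly a half-line or all of $\mathbb{R}$) and a $C^1$ open Jordan curve $\eta:(a,b)\to\mathbb{R}^2$ with $\lim_{s\to a^+}|\eta(s)|=0$ and $\lim_{s\to b^-}|\eta(s)|=+\infty$, such that either $\dot\theta(\eta(s))>0$ for all $s\in(a,b)$, or $\dot\theta(\eta(s))<0$ for all $s\in(a,b)$, where $\dot\theta(x,y)=\dfrac{xQ(x,y)-yP(x,y)}{x^2+y^2}$ is the angular speed of the system in polar coordinates. Then the system has at most one limit cycle.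
   Context: A limit cycle is an isolated non-trivial periodic orbit. $P_x, P_y, Q_x, Q_y$ denote partial derivatives. $\theta$ denotes the polar angle around the origin, so along solutions $\dot\theta=(x\dot y-y\dot x)/(x^2+y^2)$. *)

theory Defs
  imports "HOL-Analysis.Analysis"
begin

definition partial_x :: "(real \<times> real \<Rightarrow> real) \<Rightarrow> real \<times> real \<Rightarrow> real" where
  "partial_x f z = deriv (\<lambda>t. f (t, snd z)) (fst z)"

definition partial_y :: "(real \<times> real \<Rightarrow> real) \<Rightarrow> real \<times> real \<Rightarrow> real" where
  "partial_y f z = deriv (\<lambda>t. f (fst z, t)) (snd z)"

definition C1_plane :: "(real \<times> real \<Rightarrow> real) \<Rightarrow> bool" where
  "C1_plane f \<longleftrightarrow> (\<forall>z. f differentiable (at z))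
      \<and> continuous_on UNIV (partial_x f) \<and> continuous_on UNIV (partial_y f)"

definition is_solution :: "(real \<times> real \<Rightarrow> real) \<Rightarrow> (real \<times> real \<Rightarrow> real) \<Rightarrow> (real \<Rightarrow> real \<times> real) \<Rightarrow> bool" where
  "is_solution P Q \<gamma> \<longleftrightarrow> (\<forall>t. (\<gamma> has_vector_derivative (P (\<gamma> t), Q (\<gamma> t))) (at t))"

definition periodic_orbit :: "(real \<times> real \<Rightarrow> real) \<Rightarrow> (real \<times> real \<Rightarrow> real) \<Rightarrow> (real \<times> real) set \<Rightarrow> bool" where
  "periodic_orbit P Q \<Gamma> \<longleftrightarrow> (\<exists>\<gamma> T. is_solution P Q \<gamma> \<and> T > 0 \<and> (\<forall>t. \<gamma> (t + T) = \<gamma> t)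
      \<and> (\<exists>t. \<gamma> t \<noteq> \<gamma> 0) \<and> \<Gamma> = range \<gamma>)"

definition limit_cycle :: "(real \<times> real \<Rightarrow> real) \<Rightarrow> (real \<times> real \<Rightarrow> real) \<Rightarrow> (real \<times> real) set \<Rightarrow> bool" where
  "limit_cycle P Q \<Gamma> \<longleftrightarrow> periodic_orbit P Q \<Gamma> \<and>
     (\<exists>U. open U \<and> \<Gamma> \<subseteq> U \<and> (\<forall>\<Gamma>'. periodic_orbit P Q \<Gamma>' \<and> \<Gamma>' \<subseteq> U \<longrightarrow> \<Gamma>' = \<Gamma>))"

definition theta_dot :: "(real \<times> real \<Rightarrow> real) \<Rightarrow> (real \<times> real \<Rightarrow> real) \<Rightarrow> real \<times> real \<Rightarrow> real" where
  "theta_dot P Q z = (fst z * Q z - snd z * P z) / ((fst z)\<^sup>2 + (snd z)\<^sup>2)"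

definition alpha :: "(real \<times> real \<Rightarrow> real) \<Rightarrow> (real \<times> real \<Rightarrow> real) \<Rightarrow> real \<times> real \<Rightarrow> real" where
  "alpha P Q z = P z * (fst z * partial_x Q z + snd z * partial_y Q z)
                 - Q z * (fst z * partial_x P z + snd z * partial_y P z)"

definition lin_indep2 :: "real \<times> real \<Rightarrow> real \<times> real \<Rightarrow> bool" where
  "lin_indep2 u v \<longleftrightarrow> (\<forall>c d::real. c *\<^sub>R u + d *\<^sub>R v = 0 \<longrightarrow> c = 0 \<and> d = 0)"

definition left_end :: "ereal \<Rightarrow> real filter" where
  "left_end a = (if a = -\<infinity> then at_bot else at_right (real_of_ereal a))"

definition right_end :: "ereal \<Rightarrow> real filter" where
  "right_end b = (if b = \<infinity> then at_top else at_left (real_of_ereal b))"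

end

theory Submission
  imports Defs
begin

text \<open>Identify the plane with the complex numbers and the system with \<open>w' = F w\<close>. The condition
  \<open>\<alpha> \<ge> 0\<close> says that the direction of \<open>F\<close> turns counterclockwise along every ray. It also gives
  \<open>g' \<ge> g * div F\<close> for \<open>g = x Q - y P\<close> along solutions, so \<open>g\<close> has a constant strict sign on every
  closed orbit, which is therefore a graph \<open>ln r = u \<theta>\<close> over the angle. Two distinct closed orbits
  have graphs \<open>u\<close>, \<open>v\<close> that never meet. The slope of \<open>u\<close> is the cotangent of the angle \<open>\<phi>\<close> from the
  position to the field, so \<open>v' - u'\<close> vanishes only where the field on the two orbits is parallel;
  by Rolle's theorem this happens somewhere, which excludes condition (1).

  Under condition (2), lift \<open>\<phi>\<close> to a continuous function of \<open>(ln r, \<theta>)\<close>, which is nondecreasing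
  in \<open>ln r\<close>. The two graphs and the lifted transversal curve form a connected set on which
  \<open>sin \<phi>\<close> does not vanish, so \<open>\<phi>\<close> increases by less than \<open>\<pi>\<close> from the inner orbit to the outer
  one. Then \<open>v' \<le> u'\<close>, so by periodicity \<open>v - u\<close> is constant and \<open>\<phi>\<close> is constant between the
  two orbits on every ray. Slightly enlarged copies of the inner orbit are thus closed orbits,
  and it is not isolated.\<close>

section \<open>Scalar and linear differential equations\<close>

lemma continuous_imp_antiderivative:
  fixes k :: "real \<Rightarrow> 'a::banach"
  assumes "continuous_on UNIV k"
  obtains K where "\<And>t. (K has_vector_derivative k t) (at t)"
proof
  \<comment> \<open>The oriented integral from 0 to \<open>t\<close>: for
    \<open>t \<noteq> 0\<close> one of the two intervals is empty.\<close>
  let ?K = "\<lambda>t. integral {0..t} k - integral {t..0} k"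
  fix t :: real
  \<comment> \<open>Both 0 and \<open>t\<close> lie inside the open interval, so near
    \<open>t\<close> the function \<open>?K\<close> is the integral from \<open>a\<close> up to a
    constant and is differentiable from both sides.\<close>
  define a b where "a = - \<bar>t\<bar> - 1" and "b = \<bar>t\<bar> + 1"
  have ab: "a < t" "t < b" "a < 0" "0 < b"
    unfolding a_def b_def by linarith+
  have cont: "continuous_on {x..y} k" for x y
    using assms continuous_on_subset by blast
  have int: "k integrable_on {x..y}" for x y
    using cont integrable_continuous_real by blast
  have eq: "integral {a..s} k - integral {a..0} k = ?K s" if "a < s" for s
  proof (cases "0 \<le> s")
    case True
    then have "integral {a..0} k + integral {0..s} k = integral {a..s} k"
      using ab by (intro Henstock_Kurzweil_Integration.integral_combine int) auto
    with True show ?thesis by (cases "s = 0") (auto simp: algebra_simps)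
  next
    case False
    then have "integral {a..s} k + integral {s..0} k = integral {a..0} k"
      using that by (intro Henstock_Kurzweil_Integration.integral_combine int) auto
    with False show ?thesis by (auto simp: algebra_simps)
  qed
  have "((\<lambda>s. integral {a..s} k) has_vector_derivative k t) (at t within {a..b})"
    using ab by (intro integral_has_vector_derivative cont) auto
  then have "((\<lambda>s. integral {a..s} k - integral {a..0} k) has_vector_derivative k t) (at t within {a<..<b})"
    by (auto intro!: derivative_eq_intros elim: has_vector_derivative_within_subset)
  then have "((\<lambda>s. integral {a..s} k - integral {a..0} k) has_vector_derivative k t) (at t)"
    using ab at_within_open[of t "{a<..<b}"] by simp
  then show "(?K has_vector_derivative k t) (at t)"
    by (rule has_vector_derivative_transform_within_open[where S = "{a<..<b}"]) (use ab eq in auto)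
qed

text \<open>\<open>exp (- K t)\<close> is an integrating factor. This later identifies an
  antiderivative of a logarithmic derivative as a continuous logarithm, both for an orbit and for
  the field along a ray.\<close>

lemma linear_ode_solution:
  fixes c k K :: "real \<Rightarrow> complex"
  assumes c: "\<And>t. (c has_vector_derivative c t * k t) (at t)"
    and K: "\<And>t. (K has_vector_derivative k t) (at t)"
  shows "c t = c s * exp (K t - K s)"
proof -
  have "((\<lambda>t. c t * exp (- K t)) has_vector_derivative 0) (at t)" for t
  proof -
    have "((\<lambda>t. exp (- K t)) has_vector_derivative - k t * exp (- K t)) (at t)"
      using field_vector_diff_chain_at[of "\<lambda>t. - K t" "- k t" t exp "exp (- K t)"]
      by (auto simp: o_def intro!: derivative_eq_intros K)
    then show ?thesis
      by (auto intro!: derivative_eq_intros c simp: algebra_simps)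
  qed
  then obtain d where "\<And>t. c t * exp (- K t) = d"
    using has_vector_derivative_zero_constant[of UNIV] by auto
  then have "c t * exp (- K t) = c s * exp (- K s)" by metis
  then have "c t * exp (- K t) * exp (K t) = c s * exp (- K s) * exp (K t)" by simp
  then show ?thesis
    by (simp add: exp_minus exp_diff field_simps)
qed

text \<open>\<open>w t * exp (- M * t)\<close> is nonincreasing and \<open>w t * exp (M * t)\<close>
  nondecreasing, so a zero of the nonnegative \<open>w\<close> spreads forwards and backwards in
  time.\<close>

lemma gronwall_zero:
  fixes w w' :: "real \<Rightarrow> real"
  assumes w: "\<And>t. (w has_real_derivative w' t) (at t)"
    and bound: "\<And>t. \<bar>w' t\<bar> \<le> M * w t"
    and nonneg: "\<And>t. w t \<ge> 0"
    and zero: "w s = 0"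
  shows "w t = 0"
proof (cases "s \<le> t")
  case True
  have "((\<lambda>t. w t * exp (- M * t)) has_real_derivative (w' t - M * w t) * exp (- M * t)) (at t)" for t
    by (auto intro!: derivative_eq_intros w simp: algebra_simps)
  moreover have "(w' t - M * w t) * exp (- M * t) \<le> 0" for t
    using bound[of t] by (intro mult_nonpos_nonneg) auto
  ultimately have "w t * exp (- M * t) \<le> w s * exp (- M * s)"
    using True by (intro DERIV_nonpos_imp_nonincreasing[OF True, of "\<lambda>t. w t * exp (- M * t)"]) blast
  then show ?thesis
    using zero nonneg[of t] by (simp add: mult_le_0_iff)
next
  case False
  have "((\<lambda>t. w t * exp (M * t)) has_real_derivative (w' t + M * w t) * exp (M * t)) (at t)" for t
    by (auto intro!: derivative_eq_intros w simp: algebra_simps)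
  moreover have "(w' t + M * w t) * exp (M * t) \<ge> 0" for t
    using bound[of t] by (intro mult_nonneg_nonneg) auto
  ultimately have "w t * exp (M * t) \<le> w s * exp (M * s)"
    using False by (intro DERIV_nonneg_imp_nondecreasing[of t s "\<lambda>t. w t * exp (M * t)"]) (simp, blast)
  then show ?thesis
    using zero nonneg[of t] by (simp add: mult_le_0_iff)
qed

lemma periodic_multiple:
  fixes f :: "real \<Rightarrow> 'a"
  assumes "\<And>t. f (t + p) = f t"
  shows "f (t + real n * p) = f t"
proof (induction n)
  case (Suc n)
  have "f (t + real (Suc n) * p) = f ((t + real n * p) + p)"
    by (simp add: algebra_simps)
  then show ?case using Suc assms by simp
qed simp

text \<open>Enough periods carry any point beyond any other, so each value of \<open>f\<close> is at
  most every other one.\<close>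

lemma periodic_antimono_imp_constant:
  fixes f :: "real \<Rightarrow> real"
  assumes "antimono f" and per: "\<And>t. f (t + p) = f t" and "p > 0"
  shows "f s = f t"
proof -
  have "f a \<le> f b" for a b
  proof -
    obtain n where "b - a < real n * p"
      using reals_Archimedean3[OF \<open>p > 0\<close>] by blast
    then have "f (a + real n * p) \<le> f b"
      by (intro antimonoD[OF assms(1)]) simp
    then show ?thesis
      using periodic_multiple[of f p] per by simp
  qed
  then show ?thesis by (meson antisym)
qed

lemma range_periodic:
  fixes f :: "real \<Rightarrow> 'a"
  assumes per: "\<And>t. f (t + p) = f t" and "p > 0"
  shows "range f = f ` {0..p}"
proof -
  have "f t \<in> f ` {0..p}" for t
  proof -
    obtain n where n: "- t < real n * p"
      using reals_Archimedean3[OF \<open>p > 0\<close>] by blast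
    define s where "s = t + real n * p"
    \<comment> \<open>\<open>s\<close> is positive, so \<open>nat\<close> does not truncate the
      floor.\<close>
    define m where "m = nat \<lfloor>s / p\<rfloor>"
    have "s > 0" using n by (simp add: s_def)
    then have "real m \<le> s / p" "s / p < real m + 1"
      using \<open>p > 0\<close> unfolding m_def by (auto simp: of_nat_nat)
    then have "s - real m * p \<in> {0..p}"
      using \<open>p > 0\<close> by (auto simp: field_simps)
    moreover have "f (s - real m * p) = f t"
      using periodic_multiple[of f p "s - real m * p" m] periodic_multiple[of f p t n] per
      by (simp add: s_def)
    ultimately show ?thesis by (metis imageI)
  qed
  then show ?thesis by auto
qed

text \<open>Each period raises \<open>K\<close> by the same amount \<open>A > 0\<close>, so
  \<open>K\<close> maps the line onto itself and has a global inverse. The inverse serves as a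
  change of time, and to make the angle the parameter of an orbit.\<close>

lemma periodic_increasing_inverse:
  fixes K k :: "real \<Rightarrow> real"
  assumes K: "\<And>t. (K has_real_derivative k t) (at t)"
    and pos: "\<And>t. k t > 0"
    and per: "\<And>t. k (t + p) = k t" and p: "p > 0"
  obtains \<sigma> A where "A > 0" "\<And>t. K (t + p) = K t + A"
    "\<And>x. K (\<sigma> x) = x" "\<And>t. \<sigma> (K t) = t"
    "\<And>x. (\<sigma> has_real_derivative 1 / k (\<sigma> x)) (at x)"
    "\<And>x. \<sigma> (x + A) = \<sigma> x + p"
proof -
  have mono: "K s < K t" if "s < t" for s t
    using DERIV_pos_imp_increasing[OF that, of K] K pos by blast
  have contK: "isCont K t" for t
    using K DERIV_isCont by blast
  define A where "A = K p - K 0"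
  have A: "A > 0" using mono[OF p] by (simp add: A_def)
  have "((\<lambda>t. K (t + p) - K t) has_real_derivative 0) (at t)" for t
  proof -
    have "((\<lambda>t. K (t + p)) has_real_derivative k (t + p)) (at t)"
      using DERIV_shift K by blast
    from DERIV_diff[OF this K] show ?thesis by (simp add: per)
  qed
  then have "K (t + p) - K t = K (0 + p) - K 0" for t
    using DERIV_isconst_all by blast
  then have KA: "K (t + p) = K t + A" for t
    unfolding A_def by (metis add_0 add_diff_cancel_left' add_diff_eq diff_add_cancel)
  have KnA: "K (t + real n * p) = K t + real n * A" for t n
  proof (induction n)
    case (Suc n)
    have "K (t + real (Suc n) * p) = K ((t + real n * p) + p)"
      by (simp add: algebra_simps)
    also have "\<dots> = K (t + real n * p) + A" by (rule KA)
    finally show ?case using Suc by (simp add: algebra_simps)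
  qed simp
  have "\<exists>t. K t = x" for x
  proof -
    obtain n where n: "\<bar>x - K 0\<bar> < real n * A"
      using reals_Archimedean3[OF A] by blast
    have "K (- real n * p) \<le> x"
      using n KnA[of "- real n * p" n] by (auto simp: abs_less_iff)
    moreover have "x \<le> K (real n * p)"
      using n KnA[of 0 n] by (auto simp: abs_less_iff)
    moreover have "- real n * p \<le> real n * p"
      using p by simp
    ultimately show ?thesis
      using IVT'[of K "- real n * p" x "real n * p"] contK continuous_at_imp_continuous_on by blast
  qed
  then obtain \<sigma> where K\<sigma>: "\<And>x. K (\<sigma> x) = x" by metis
  have \<sigma>K: "\<sigma> (K t) = t" for t
    using mono K\<sigma> by (metis less_irrefl linorder_neqE)
  have "isCont \<sigma> x" for x
    using isCont_inverse_function[where d = 1 and x = "\<sigma> x" and g = \<sigma> and f = K] \<sigma>K contK K\<sigma> by simp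
  then have "(\<sigma> has_real_derivative inverse (k (\<sigma> x))) (at x)" for x
    using DERIV_inverse_function[where f = K and g = \<sigma> and x = x and a = "x - 1" and b = "x + 1", OF K] pos[of "\<sigma> x"] K\<sigma>
    by fastforce
  moreover have "\<sigma> (x + A) = \<sigma> x + p" for x
    by (metis KA K\<sigma> \<sigma>K)
  ultimately show ?thesis
    using that[of A \<sigma>] A KA K\<sigma> \<sigma>K by (simp add: inverse_eq_divide)
qed

section \<open>Closed orbits of planar vector fields\<close>

text \<open>\<open>p\<close> is any positive period, not necessarily the least one; the last
  conjunct excludes equilibria.\<close>

definition closed_orbit :: "(complex \<Rightarrow> complex) \<Rightarrow> (real \<Rightarrow> complex) \<Rightarrow> real \<Rightarrow> bool" where
  "closed_orbit F c p \<longleftrightarrow> p > 0 \<and> (\<forall>t. (c has_vector_derivative F (c t)) (at t))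
      \<and> (\<forall>t. c (t + p) = c t) \<and> (\<exists>t. c t \<noteq> c 0)"

lemma closed_orbitD:
  assumes "closed_orbit F c p"
  shows "p > 0" "(c has_vector_derivative F (c t)) (at t)" "c (t + p) = c t" "\<exists>t. c t \<noteq> c 0"
  using assms unfolding closed_orbit_def by auto

lemma solution_continuous:
  assumes "\<And>t. (c has_vector_derivative F (c t)) (at t)"
  shows "continuous_on S c"
  by (meson assms continuous_at_imp_continuous_on has_vector_derivative_continuous)

lemma closed_orbit_compact:
  assumes "closed_orbit F c p"
  shows "compact (range c)"
proof -
  have "range c = c ` {0..p}"
    using range_periodic closed_orbitD(1,3)[OF assms] by blast
  then show ?thesis
    using compact_continuous_image[OF solution_continuous compact_Icc] closed_orbitD(2)[OF assms] by metis
qed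

text \<open>Time reversal reduces clockwise motion to counterclockwise motion.\<close>

lemma closed_orbit_reverse:
  assumes "closed_orbit F c p"
  shows "closed_orbit (\<lambda>w. - F w) (\<lambda>t. c (- t)) p"
proof -
  note c = closed_orbitD[OF assms]
  have "((\<lambda>t. c (- t)) has_vector_derivative - F (c (- t))) (at t)" for t
  proof -
    have "(uminus has_vector_derivative - 1) (at t)"
      by (intro derivative_intros)
    from vector_diff_chain_at[OF this c(2)] show ?thesis by (simp add: o_def)
  qed
  moreover have "c (- (t + p)) = c (- t)" for t
    using c(3)[of "- t - p"] by simp
  moreover have "\<exists>t. c (- t) \<noteq> c (- 0)"
    using c(4) by (metis add.inverse_inverse neg_0_equal_iff_equal)
  ultimately show ?thesis
    using c(1) unfolding closed_orbit_def by blast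
qed

text \<open>With an antiderivative of the speed factor \<open>k\<close> as new time, the curve
  becomes a solution. The new period is the growth of this antiderivative over
  \<open>p\<close>.\<close>

lemma closed_orbit_reparametrize:
  assumes c: "\<And>t. (c has_vector_derivative k t *\<^sub>R F (c t)) (at t)"
    and k: "continuous_on UNIV k" "\<And>t. k t > 0" "\<And>t. k (t + p) = k t"
    and p: "p > 0" "\<And>t. c (t + p) = c t" and nc: "\<exists>t. c t \<noteq> c 0"
  obtains d q where "closed_orbit F d q" "range d = range c"
proof -
  obtain K where K: "\<And>t. (K has_real_derivative k t) (at t)"
    using continuous_imp_antiderivative[OF k(1)] has_real_derivative_iff_has_vector_derivative by metis
  obtain \<sigma> A where \<sigma>: "A > 0" "\<And>x. K (\<sigma> x) = x" "\<And>t. \<sigma> (K t) = t"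
    "\<And>x. (\<sigma> has_real_derivative 1 / k (\<sigma> x)) (at x)" "\<And>x. \<sigma> (x + A) = \<sigma> x + p"
    using periodic_increasing_inverse[OF K k(2,3) p(1)] by metis
  have "((c \<circ> \<sigma>) has_vector_derivative F ((c \<circ> \<sigma>) x)) (at x)" for x
  proof -
    have "((c \<circ> \<sigma>) has_vector_derivative (1 / k (\<sigma> x)) *\<^sub>R k (\<sigma> x) *\<^sub>R F (c (\<sigma> x))) (at x)"
      using vector_diff_chain_at[OF \<sigma>(4)[unfolded has_real_derivative_iff_has_vector_derivative] c] .
    then show ?thesis using k(2)[of "\<sigma> x"] by simp
  qed
  moreover have "(c \<circ> \<sigma>) (x + A) = (c \<circ> \<sigma>) x" for x
    using p(2) \<sigma>(5) by simp
  moreover have "\<exists>x. (c \<circ> \<sigma>) x \<noteq> (c \<circ> \<sigma>) 0"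
    using nc \<sigma>(3) by (metis comp_apply)
  ultimately have "closed_orbit F (c \<circ> \<sigma>) A"
    using \<sigma>(1) unfolding closed_orbit_def by blast
  moreover have "range (c \<circ> \<sigma>) = range c"
    using \<sigma>(3) by (metis image_comp surjI)
  ultimately show ?thesis using that by blast
qed

text \<open>The real and imaginary parts of \<open>F w / w\<close> are \<open>r' / r\<close> and \<open>\<theta>'\<close> along solutions, so
  \<open>u = ln r\<close> as a function of \<open>\<theta>\<close> has their quotient as derivative. The orbit is not assumed
  to close up after one turn, hence the \<open>n\<close>.\<close>

lemma closed_orbit_polar_pos:
  assumes contF: "continuous_on UNIV F"
    and c: "closed_orbit F c p" and nz: "\<And>t. c t \<noteq> 0"
    and rot: "\<And>t. Im (F (c t) / c t) > 0"
  obtains u n where "n > 0" "\<And>\<theta>. u (\<theta> + real n * (2 * pi)) = u \<theta>"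
    "range c = range (\<lambda>\<theta>. exp (Complex (u \<theta>) \<theta>))"
    "\<And>\<theta> w. w = exp (Complex (u \<theta>) \<theta>) \<Longrightarrow> (u has_real_derivative Re (F w / w) / Im (F w / w)) (at \<theta>)"
proof -
  note cD = closed_orbitD[OF c]
  define k where "k t = F (c t) / c t" for t
  have contc: "continuous_on UNIV c"
    using solution_continuous cD(2) by blast
  have "continuous_on UNIV k"
    unfolding k_def using nz contc continuous_on_compose2[OF contF contc]
    by (intro continuous_intros) auto
  then obtain K0 where K0: "\<And>t. (K0 has_vector_derivative k t) (at t)"
    using continuous_imp_antiderivative by blast
  \<comment> \<open>The constant makes \<open>exp (K 0) = c 0\<close>, so \<open>K\<close> is a
    continuous logarithm of the orbit: its real part is ln r and its imaginary part a lifted polar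
    angle.\<close>
  define K where "K t = K0 t - K0 0 + Ln (c 0)" for t
  have K: "(K has_vector_derivative k t) (at t)" for t
    unfolding K_def by (auto intro!: derivative_eq_intros K0)
  have "(c has_vector_derivative c t * k t) (at t)" for t
    using cD(2)[of t] nz[of t] by (simp add: k_def)
  from linear_ode_solution[OF this K] have "c t = c 0 * exp (K t - K 0)" for t .
  moreover have "exp (K 0) = c 0"
    using nz by (simp add: K_def)
  ultimately have expK: "exp (K t) = c t" for t
    by (simp add: exp_diff nz)
  have ImK: "((\<lambda>t. Im (K t)) has_real_derivative Im (k t)) (at t)"
    and ReK: "((\<lambda>t. Re (K t)) has_real_derivative Re (k t)) (at t)" for t
    using K[of t] by (simp_all add: has_vector_derivative_complex_iff)
  have kper: "Im (k (t + p)) = Im (k t)" and kpos: "Im (k t) > 0" for t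
    using rot cD(3) by (simp_all add: k_def)
  obtain \<sigma> A where \<sigma>: "A > 0" "\<And>t. Im (K (t + p)) = Im (K t) + A" "\<And>x. Im (K (\<sigma> x)) = x"
    "\<And>t. \<sigma> (Im (K t)) = t" "\<And>x. (\<sigma> has_real_derivative 1 / Im (k (\<sigma> x))) (at x)"
    "\<And>x. \<sigma> (x + A) = \<sigma> x + p"
    using periodic_increasing_inverse[OF ImK kpos kper cD(1)] by metis
  \<comment> \<open>The orbit closes up after time \<open>p\<close>, so the gain \<open>A\<close> of
    the lifted angle is a multiple of 2 pi, and a positive one because the angle increases.\<close>
  have "exp (K (0 + p)) = exp (K 0)"
    using expK cD(3) by metis
  then obtain m :: int where "Im (K (0 + p)) = Im (K 0) + of_int (2 * m) * pi"
    by (auto simp: exp_eq)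
  then have A: "A = of_int m * (2 * pi)"
    using \<sigma>(2)[of 0] by simp
  with \<sigma>(1) have "m > 0"
    by (simp add: zero_less_mult_iff)
  with A have A: "A = real (nat m) * (2 * pi)" "nat m > 0"
    by (auto simp: of_nat_nat)
  \<comment> \<open>ln r at the time \<open>\<sigma> \<theta>\<close> at which the lifted angle
    equals \<open>\<theta>\<close>.\<close>
  define u where "u \<theta> = Re (K (\<sigma> \<theta>))" for \<theta>
  have eu: "exp (Complex (u \<theta>) \<theta>) = c (\<sigma> \<theta>)" for \<theta>
    using expK[of "\<sigma> \<theta>"] \<sigma>(3)[of \<theta>] by (metis complex_surj u_def)
  have "u (\<theta> + A) = u \<theta>" for \<theta>
  proof -
    have "norm (exp (K (\<sigma> \<theta> + p))) = norm (exp (K (\<sigma> \<theta>)))"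
      using expK cD(3) by metis
    then show ?thesis by (simp add: u_def \<sigma>(6))
  qed
  moreover have "range c = range (\<lambda>\<theta>. exp (Complex (u \<theta>) \<theta>))"
  proof -
    have "c t \<in> range (\<lambda>\<theta>. c (\<sigma> \<theta>))" for t
      using rangeI[of "\<lambda>\<theta>. c (\<sigma> \<theta>)" "Im (K t)"] by (simp add: \<sigma>(4))
    then show ?thesis unfolding eu by auto
  qed
  moreover have "(u has_real_derivative Re (F w / w) / Im (F w / w)) (at \<theta>)"
    if "w = exp (Complex (u \<theta>) \<theta>)" for \<theta> w
  proof -
    have "(((\<lambda>t. Re (K t)) \<circ> \<sigma>) has_real_derivative Re (k (\<sigma> \<theta>)) * (1 / Im (k (\<sigma> \<theta>)))) (at \<theta>)"
      by (rule DERIV_chain[OF ReK \<sigma>(5)])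
    moreover have "(\<lambda>t. Re (K t)) \<circ> \<sigma> = u"
      by (simp add: u_def fun_eq_iff)
    ultimately show ?thesis
      by (simp add: that eu k_def)
  qed
  ultimately show ?thesis
    using that[of "nat m" u] A by simp
qed

text \<open>The clockwise case follows by time reversal: the slope is a quotient of two terms that
  both change sign when \<open>F\<close> becomes \<open>- F\<close>.\<close>

lemma closed_orbit_polar:
  assumes contF: "continuous_on UNIV F"
    and c: "closed_orbit F c p" and nz: "\<And>t. c t \<noteq> 0"
    and rot: "(\<forall>t. Im (F (c t) / c t) > 0) \<or> (\<forall>t. Im (F (c t) / c t) < 0)"
  obtains u n where "n > 0" "\<And>\<theta>. u (\<theta> + real n * (2 * pi)) = u \<theta>"
    "range c = range (\<lambda>\<theta>. exp (Complex (u \<theta>) \<theta>))"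
    "\<And>\<theta> w. w = exp (Complex (u \<theta>) \<theta>) \<Longrightarrow> (u has_real_derivative Re (F w / w) / Im (F w / w)) (at \<theta>)"
  using rot
proof
  assume "\<forall>t. Im (F (c t) / c t) > 0"
  then have pos: "Im (F (c t) / c t) > 0" for t by blast
  show ?thesis
    by (rule closed_orbit_polar_pos[OF contF c nz pos]) (rule that, assumption+)
next
  assume neg: "\<forall>t. Im (F (c t) / c t) < 0"
  have range: "range (\<lambda>t. c (- t)) = range c"
    using surj_uminus by (metis (no_types) image_image)
  show ?thesis
  proof (rule closed_orbit_polar_pos[of "\<lambda>w. - F w" "\<lambda>t. c (- t)" p])
    show "continuous_on UNIV (\<lambda>w. - F w)"
      by (intro continuous_intros contF)
    show "closed_orbit (\<lambda>w. - F w) (\<lambda>t. c (- t)) p"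
      by (rule closed_orbit_reverse[OF c])
    fix u n
    assume u: "n > 0" "\<And>\<theta>. u (\<theta> + real n * (2 * pi)) = u \<theta>"
      "range (\<lambda>t. c (- t)) = range (\<lambda>\<theta>. exp (Complex (u \<theta>) \<theta>))"
      and u': "\<And>\<theta> w. w = exp (Complex (u \<theta>) \<theta>) \<Longrightarrow> (u has_real_derivative Re (- F w / w) / Im (- F w / w)) (at \<theta>)"
    show ?thesis
    proof (rule that[of n u])
      fix \<theta> w
      assume "w = exp (Complex (u \<theta>) \<theta>)"
      from u'[OF this] show "(u has_real_derivative Re (F w / w) / Im (F w / w)) (at \<theta>)"
        by simp
    qed (use u range in auto)
  qed (use nz neg in auto)
qed

section \<open>Fields whose direction turns monotonically along rays\<close>

text \<open>\<open>Im (cnj a * b)\<close> is the determinant of \<open>a\<close> and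
  \<open>b\<close>, and \<open>DF w w\<close> is r times the radial derivative of \<open>F\<close>;
  \<open>turning\<close> is therefore the condition \<alpha> \<ge> 0. The values of
  \<open>DF\<close> at \<open>1\<close> and \<open>\<i>\<close> carry the partial
  derivatives.\<close>

locale radially_turning_field =
  fixes F :: "complex \<Rightarrow> complex" and DF :: "complex \<Rightarrow> complex \<Rightarrow> complex"
  assumes deriv: "(F has_derivative DF w) (at w)"
    and cont_1: "continuous_on UNIV (\<lambda>w. DF w 1)"
    and cont_i: "continuous_on UNIV (\<lambda>w. DF w \<i>)"
    and zero_iff: "F w = 0 \<longleftrightarrow> w = 0"
    and turning: "Im (cnj (F w) * DF w w) \<ge> 0"
begin

section \<open>Uniqueness of bounded solutions and the sign of rotation of closed orbits\<close>

lemma contF: "continuous_on S F"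
  using deriv has_derivative_continuous continuous_at_imp_continuous_on by blast

lemma DF_expand: "DF w v = Re v *\<^sub>R DF w 1 + Im v *\<^sub>R DF w \<i>"
proof -
  interpret linear "DF w"
    using deriv has_derivative_linear by blast
  have "v = Re v *\<^sub>R 1 + Im v *\<^sub>R \<i>"
    by (simp add: complex_eq_iff)
  then have "DF w v = DF w (Re v *\<^sub>R 1 + Im v *\<^sub>R \<i>)" by simp
  then show ?thesis by (simp only: add scale)
qed

text \<open>The partial derivatives are bounded on the compact disc, which is convex, so the mean
  value inequality applies.\<close>

lemma Lipschitz_on_cball:
  obtains L where "L \<ge> 0" "\<And>x y. norm x \<le> R \<Longrightarrow> norm y \<le> R \<Longrightarrow> norm (F x - F y) \<le> L * norm (x - y)"
proof -
  have "bounded ((\<lambda>w. DF w 1) ` cball 0 R)" "bounded ((\<lambda>w. DF w \<i>) ` cball 0 R)"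
    using cont_1 cont_i
    by (metis compact_cball compact_continuous_image compact_imp_bounded continuous_on_subset subset_UNIV)+
  then obtain M N where MN: "\<And>w. norm w \<le> R \<Longrightarrow> norm (DF w 1) \<le> M"
    "\<And>w. norm w \<le> R \<Longrightarrow> norm (DF w \<i>) \<le> N" and "M > 0" "N > 0"
    unfolding bounded_pos by (metis imageI mem_cball_0)
  have *: "norm (DF w v) \<le> (M + N) * norm v" if "norm w \<le> R" for w v
  proof -
    have "norm (DF w v) \<le> norm (Re v *\<^sub>R DF w 1) + norm (Im v *\<^sub>R DF w \<i>)"
      using DF_expand[of w v] norm_triangle_ineq by metis
    also have "\<dots> = \<bar>Re v\<bar> * norm (DF w 1) + \<bar>Im v\<bar> * norm (DF w \<i>)" by simp
    also have "\<dots> \<le> norm v * M + norm v * N"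
      using MN[OF that] by (intro add_mono mult_mono abs_Re_le_cmod abs_Im_le_cmod) auto
    finally show ?thesis by (simp add: algebra_simps)
  qed
  show ?thesis
  proof
    show "M + N \<ge> 0" using \<open>M > 0\<close> \<open>N > 0\<close> by simp
    fix x y :: complex assume "norm x \<le> R" "norm y \<le> R"
    then show "norm (F x - F y) \<le> (M + N) * norm (x - y)"
      using * by (intro differentiable_bound[of "cball 0 R" F DF])
        (auto intro!: has_derivative_at_withinI deriv onorm_bound less_imp_le[OF add_pos_pos[OF \<open>M > 0\<close> \<open>N > 0\<close>]])
  qed
qed

text \<open>One Lipschitz constant \<open>L\<close> serves for all times, since both solutions stay
  in a common disc. The squared distance then has derivative at most \<open>2 * L\<close> times
  itself in absolute value.\<close>

lemma bounded_solutions_agree: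
  assumes c: "\<And>t. (c has_vector_derivative F (c t)) (at t)"
    and d: "\<And>t. (d has_vector_derivative F (d t)) (at t)"
    and bdd: "bounded (range c)" "bounded (range d)"
    and eq: "c s = d s"
  shows "c t = d t"
proof -
  obtain R1 R2 where "\<And>t. norm (c t) \<le> R1" "\<And>t. norm (d t) \<le> R2"
    using bdd unfolding bounded_iff by auto
  then have R: "norm (c t) \<le> max R1 R2" "norm (d t) \<le> max R1 R2" for t
    by (simp_all add: le_max_iff_disj)
  obtain L where L: "L \<ge> 0"
    "\<And>x y. norm x \<le> max R1 R2 \<Longrightarrow> norm y \<le> max R1 R2 \<Longrightarrow> norm (F x - F y) \<le> L * norm (x - y)"
    using Lipschitz_on_cball[of "max R1 R2"] by blast
  define e where "e t = c t - d t" for t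
  define e' where "e' t = F (c t) - F (d t)" for t
  have "(e has_vector_derivative e' t) (at t)" for t
    unfolding e_def e'_def by (intro derivative_intros c d)
  then have der: "((\<lambda>t. e t \<bullet> e t) has_real_derivative 2 * (e t \<bullet> e' t)) (at t)" for t
    using bounded_bilinear.has_vector_derivative[OF bounded_bilinear_inner, of e "e' t" t UNIV e "e' t"]
    by (simp add: has_real_derivative_iff_has_vector_derivative inner_commute)
  have "\<bar>2 * (e t \<bullet> e' t)\<bar> \<le> 2 * L * (e t \<bullet> e t)" for t
  proof -
    have "\<bar>e t \<bullet> e' t\<bar> \<le> norm (e t) * norm (e' t)"
      by (rule Cauchy_Schwarz_ineq2)
    also have "\<dots> \<le> norm (e t) * (L * norm (e t))"
      using L(2)[OF R] by (intro mult_left_mono) (auto simp: e_def e'_def)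
    finally show ?thesis
      by (simp add: dot_square_norm power2_eq_square algebra_simps)
  qed
  from gronwall_zero[OF der this] have "e t \<bullet> e t = 0"
    using eq by (simp add: e_def)
  then show ?thesis by (simp add: e_def)
qed

lemma shifted_solution:
  assumes "\<And>t. (c has_vector_derivative F (c t)) (at t)"
  shows "((\<lambda>t. c (t + a)) has_vector_derivative F (c (t + a))) (at t)"
proof -
  have "((\<lambda>t. t + a) has_vector_derivative 1) (at t)"
    by (auto intro!: derivative_eq_intros)
  from vector_diff_chain_at[OF this assms] show ?thesis by (simp add: o_def)
qed

text \<open>The system is autonomous: time shifts place the common point at time 0 of both
  solutions, and uniqueness applies.\<close>

lemma closed_orbits_meet_imp_eq:
  assumes c: "closed_orbit F c p" and d: "closed_orbit F d q"
    and meet: "range c \<inter> range d \<noteq> {}"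
  shows "range c = range d"
proof -
  obtain a b where ab: "c a = d b" using meet by auto
  have range: "range (\<lambda>t. f (t + a)) = range f" for f :: "real \<Rightarrow> complex" and a
    using surj_plus_right[of a] by (metis (no_types) image_image)
  have "c (t + a) = d (t + b)" for t
  proof (rule bounded_solutions_agree[of "\<lambda>t. c (t + a)" "\<lambda>t. d (t + b)" 0])
    show "bounded (range (\<lambda>t. c (t + a)))" "bounded (range (\<lambda>t. d (t + b)))"
      using c d range closed_orbit_compact compact_imp_bounded by metis+
  qed (use c d ab in \<open>auto intro!: shifted_solution dest: closed_orbitD\<close>)
  then have "range (\<lambda>t. c (t + a)) = range (\<lambda>t. d (t + b))" by simp
  then show ?thesis by (simp add: range)
qed

text \<open>The origin is a constant solution, which by uniqueness no closed orbit can
  reach.\<close>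

lemma closed_orbit_nonzero:
  assumes c: "closed_orbit F c p"
  shows "c t \<noteq> 0"
proof
  assume "c t = 0"
  then have "c s = 0" for s
    using bounded_solutions_agree[of c "\<lambda>_. 0" t s] closed_orbitD(2)[OF c] zero_iff[of 0]
      compact_imp_bounded[OF closed_orbit_compact[OF c]]
    by simp
  then show False using closed_orbitD(4)[OF c] by simp
qed

text \<open>Along a solution, \<open>g = Im (cnj c * F c)\<close> satisfies \<open>g' = \<alpha> + g * div F\<close>
  with \<open>\<alpha> \<ge> 0\<close>, so \<open>g\<close> times a positive integrating factor is nondecreasing; on a closed
  orbit this leaves no room for a change of sign.\<close>

lemma closed_orbit_rotates:
  assumes c: "closed_orbit F c p"
  shows "(\<forall>t. Im (F (c t) / c t) > 0) \<or> (\<forall>t. Im (F (c t) / c t) < 0)"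
proof -
  note cD = closed_orbitD[OF c]
  have contc: "continuous_on UNIV c"
    using solution_continuous cD(2) by blast
  define g where "g t = Im (cnj (c t) * F (c t))" for t
  define dv where "dv t = Re (DF (c t) 1) + Im (DF (c t) \<i>)" for t
  define al where "al t = Im (cnj (F (c t)) * DF (c t) (c t))" for t
  have g: "(g has_real_derivative al t + g t * dv t) (at t)" for t
  proof -
    have Fc: "((\<lambda>t. F (c t)) has_vector_derivative DF (c t) (F (c t))) (at t)"
      using vector_derivative_diff_chain_within[OF cD(2)[of t] has_derivative_at_withinI[OF deriv]]
      by (simp add: o_def)
    have cc: "((\<lambda>t. cnj (c t)) has_vector_derivative cnj (F (c t))) (at t)"
      using bounded_linear.has_vector_derivative[OF bounded_linear_cnj cD(2)] .
    have "((\<lambda>t. cnj (c t) * F (c t)) has_vector_derivative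
        cnj (c t) * DF (c t) (F (c t)) + cnj (F (c t)) * F (c t)) (at t)"
      by (rule has_vector_derivative_mult[OF cc Fc])
    then have "(g has_real_derivative Im (cnj (c t) * DF (c t) (F (c t)) + cnj (F (c t)) * F (c t))) (at t)"
      unfolding g_def[abs_def] has_vector_derivative_complex_iff by blast
    \<comment> \<open>For a linear map A of the plane, det(w, A v) + det(A w, v) = tr(A) det(w, v).
      Here A is \<open>DF (c t)\<close>, w is \<open>c t\<close>, v is \<open>F (c t)\<close> and
      \<open>dv t\<close> is the trace; det(v, v) vanishes.\<close>
    moreover have "Im (cnj (c t) * DF (c t) (F (c t)) + cnj (F (c t)) * F (c t)) = al t + g t * dv t"
      unfolding al_def g_def dv_def DF_expand[of _ "F _"] DF_expand[of "c t" "c t"]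
      by (simp add: algebra_simps)
    ultimately show ?thesis by simp
  qed
  have contdv: "continuous_on UNIV (\<lambda>t. - dv t)"
    unfolding dv_def
    by (intro continuous_intros continuous_on_compose2[OF cont_1 contc] continuous_on_compose2[OF cont_i contc]) auto
  obtain H where H: "\<And>t. (H has_real_derivative - dv t) (at t)"
    using continuous_imp_antiderivative[OF contdv] has_real_derivative_iff_has_vector_derivative by metis
  \<comment> \<open>The integrating factor \<open>exp (H t)\<close> removes the divergence term and
    leaves a derivative that is nonnegative.\<close>
  define m where "m t = g t * exp (H t)" for t
  have m: "(m has_real_derivative al t * exp (H t)) (at t)" for t
    unfolding m_def[abs_def] by (auto intro!: derivative_eq_intros g H simp: algebra_simps)
  have mono: "m s \<le> m t" if "s \<le> t" for s t
  proof (rule DERIV_nonneg_imp_nondecreasing[OF that])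
    fix x
    show "\<exists>y. (m has_real_derivative y) (at x) \<and> 0 \<le> y"
      using m[of x] turning by (intro exI[of _ "al x * exp (H x)"]) (simp add: al_def)
  qed
  have sgn_m: "m t > 0 \<longleftrightarrow> g t > 0" "m t < 0 \<longleftrightarrow> g t < 0" for t
    by (simp_all add: m_def zero_less_mult_iff mult_less_0_iff)
  have gper: "g (t + real n * p) = g t" for t n
    using periodic_multiple[of g p] cD(3) by (simp add: g_def)
  have "(\<forall>t. g t > 0) \<or> (\<forall>t. g t < 0)"
  proof -
    \<comment> \<open>If \<open>g\<close> vanished identically, the field would always be parallel
      to the position. Where the squared radius is critical it is also orthogonal to it, so it would
      vanish off the origin.\<close>
    obtain t0 where t0: "g t0 \<noteq> 0"
    proof (rule ccontr)
      assume "\<not> thesis"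
      with that have g0: "g t = 0" for t by blast
      define r where "r t = c t \<bullet> c t" for t
      have r: "(r has_real_derivative 2 * (c t \<bullet> F (c t))) (at t)" for t
        using bounded_bilinear.has_vector_derivative[OF bounded_bilinear_inner cD(2) cD(2), of t]
        unfolding r_def by (simp add: has_real_derivative_iff_has_vector_derivative inner_commute)
      have "r 0 = r p" using cD(3)[of 0] by (simp add: r_def)
      then obtain t where "(r has_real_derivative 0) (at t)"
        using Rolle[OF cD(1), of r] r
        by (meson DERIV_isCont continuous_at_imp_continuous_on real_differentiable_def)
      then have "c t \<bullet> F (c t) = 0"
        using DERIV_unique[OF r] by fastforce
      then have "cnj (c t) * F (c t) = 0"
        using g0[of t] by (simp add: complex_eq_iff g_def inner_complex_def)
      then show False
        using zero_iff closed_orbit_nonzero[OF c, of t] by simp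
    qed
    then consider "g t0 > 0" | "g t0 < 0" by linarith
    then show ?thesis
    proof cases
      case 1
      \<comment> \<open>Periods move \<open>t\<close> past \<open>t0\<close>, where monotonicity of
        \<open>m\<close> gives the sign; \<open>m\<close> need not be periodic, but it has the sign
        of the periodic \<open>g\<close>. For a negative sign \<open>t0\<close> is moved
        instead.\<close>
      have "g t > 0" for t
      proof -
        obtain n where "t0 - t < real n * p"
          using reals_Archimedean3[OF cD(1)] by blast
        then have "m t0 \<le> m (t + real n * p)" by (intro mono) simp
        with 1 have "g (t + real n * p) > 0" using sgn_m by (metis less_le_trans)
        then show ?thesis by (simp add: gper)
      qed
      then show ?thesis by blast
    next
      case 2
      have "g t < 0" for t
      proof -
        obtain n where "t - t0 < real n * p"
          using reals_Archimedean3[OF cD(1)] by blast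
        then have "m t \<le> m (t0 + real n * p)" by (intro mono) simp
        moreover have "g (t0 + real n * p) < 0" using 2 by (simp add: gper)
        ultimately show ?thesis using sgn_m by (metis le_less_trans)
      qed
      then show ?thesis by blast
    qed
  qed
  moreover have "Im (F (c t) / c t) = g t / (norm (c t))\<^sup>2" for t
    by (simp add: g_def complex_div_cnj[of "F (c t)"] mult.commute)
  ultimately show ?thesis
    using closed_orbit_nonzero[OF c] by (auto simp: zero_less_divide_iff divide_less_0_iff)
qed

lemma closed_orbit_polar_form:
  assumes c: "closed_orbit F c p"
  obtains u n where "n > 0" "\<And>\<theta>. u (\<theta> + real n * (2 * pi)) = u \<theta>"
    "range c = range (\<lambda>\<theta>. exp (Complex (u \<theta>) \<theta>))"
    "\<And>\<theta> w. w = exp (Complex (u \<theta>) \<theta>) \<Longrightarrow> (u has_real_derivative Re (F w / w) / Im (F w / w)) (at \<theta>)"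
  by (rule closed_orbit_polar[OF contF c closed_orbit_nonzero[OF c] closed_orbit_rotates[OF c]])
    (rule that, assumption+)

end

section \<open>The lifted direction angle\<close>

text \<open>Distinct values of \<open>h\<close> differ by nonzero multiples of 2 pi i, so its range
  is discrete.\<close>

lemma continuous_exp_constant:
  fixes h :: "real \<Rightarrow> complex"
  assumes cont: "continuous_on UNIV h" and eq: "\<And>s t. exp (h s) = exp (h t)"
  shows "h s = h t"
proof -
  have "h constant_on UNIV"
  proof (rule continuous_discrete_range_constant[OF _ cont])
    fix x
    have "2 * pi \<le> norm (h y - h x)" if "h y \<noteq> h x" for y
    proof -
      obtain n :: int where n: "h y = h x + (of_int (2 * n) * pi) * \<i>"
        using eq[of y x] unfolding exp_eq by blast
      with that have "n \<noteq> 0" by auto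
      then have "1 \<le> \<bar>real_of_int n\<bar>" by linarith
      then show ?thesis
        using n by (simp add: norm_mult)
    qed
    then show "\<exists>e>0. \<forall>y. y \<in> UNIV \<and> h y \<noteq> h x \<longrightarrow> e \<le> norm (h y - h x)"
      by (intro exI[of _ "2 * pi"]) auto
  qed simp
  then show ?thesis unfolding constant_on_def by auto
qed

text \<open>A rise by pi or more would make \<open>\<phi>\<close> attain
  \<open>\<phi> x + pi\<close> on \<open>S\<close>, where the sine is negative.\<close>

lemma connected_sin_pos:
  fixes \<phi> :: "'a::topological_space \<Rightarrow> real"
  assumes "connected S" "continuous_on S \<phi>" and pos: "\<And>z. z \<in> S \<Longrightarrow> sin (\<phi> z) > 0"
    and xy: "x \<in> S" "y \<in> S"
  shows "\<phi> y - \<phi> x < pi"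
proof (rule ccontr)
  assume "\<not> \<phi> y - \<phi> x < pi"
  then have "\<phi> x + pi \<in> {\<phi> x..\<phi> y}" by auto
  moreover have "{\<phi> x..\<phi> y} \<subseteq> \<phi> ` S"
    using assms by (intro connected_contains_Icc connected_continuous_image) auto
  ultimately have "\<phi> x + pi \<in> \<phi> ` S" by (rule subsetD[rotated])
  then obtain z where "z \<in> S" "\<phi> z = \<phi> x + pi" by auto
  then show False using pos[OF \<open>z \<in> S\<close>] pos[OF xy(1)] by simp
qed

text \<open>For arguments \<alpha> of \<open>a\<close> and \<beta> of \<open>b\<close> this is cot
  \<beta> - cot \<alpha> = - sin (\<beta> - \<alpha>) / (sin \<alpha> sin \<beta>).\<close>

lemma cot_difference:
  fixes a b :: complex
  assumes "Im a \<noteq> 0" "Im b \<noteq> 0"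
  shows "Re b / Im b - Re a / Im a = - Im (cnj a * b) / (Im a * Im b)"
  using assms by (simp add: field_simps)

context radially_turning_field
begin

text \<open>\<open>exp\<close> never vanishes, so neither does \<open>F (exp \<zeta>)\<close>, and
  on the contractible plane it has a continuous logarithm. The logarithmic derivative of
  \<open>F\<close> along a ray has imaginary part \<alpha> divided by the squared norm of
  \<open>F\<close>, hence nonnegative.\<close>

lemma direction_lift:
  obtains \<Psi> where "continuous_on UNIV \<Psi>" "\<And>\<zeta>. F (exp \<zeta>) = exp (\<Psi> \<zeta>)"
    "\<And>s t \<theta>. s \<le> t \<Longrightarrow> Im (\<Psi> (Complex s \<theta>)) \<le> Im (\<Psi> (Complex t \<theta>))"
proof -
  have "continuous_on UNIV (\<lambda>\<zeta>. F (exp \<zeta>))"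
    by (rule continuous_on_compose2[OF contF]) (auto intro: continuous_intros)
  then obtain \<Psi> where \<Psi>: "continuous_on UNIV \<Psi>" "\<And>\<zeta>. F (exp \<zeta>) = exp (\<Psi> \<zeta>)"
    using continuous_logarithm_on_contractible[of UNIV "\<lambda>\<zeta>. F (exp \<zeta>)"]
      convex_imp_contractible[OF convex_UNIV] zero_iff by (metis UNIV_I exp_not_eq_zero)
  have "Im (\<Psi> (Complex s \<theta>)) \<le> Im (\<Psi> (Complex t \<theta>))" if "s \<le> t" for s t \<theta>
  proof -
    define w where "w s = exp (Complex s \<theta>)" for s
    have w0: "w s \<noteq> 0" for s by (simp add: w_def)
    have "((\<lambda>s. Complex s \<theta>) has_vector_derivative 1) (at s)" for s
      by (auto simp: has_vector_derivative_complex_iff intro!: derivative_eq_intros)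
    from field_vector_diff_chain_at[OF this DERIV_exp]
    have w: "(w has_vector_derivative w s) (at s)" for s
      by (simp add: o_def w_def[abs_def])
    then have contw: "continuous_on UNIV w"
      by (meson continuous_at_imp_continuous_on has_vector_derivative_continuous)
    define k where "k s = DF (w s) (w s) / F (w s)" for s
    have Fw: "((\<lambda>s. F (w s)) has_vector_derivative F (w s) * k s) (at s)" for s
      using vector_derivative_diff_chain_within[OF w[of s] has_derivative_at_withinI[OF deriv]] w0
      by (simp add: o_def k_def zero_iff)
    have "continuous_on UNIV k"
      unfolding k_def DF_expand[of _ "w _"] using w0
      by (intro continuous_intros continuous_on_compose2[OF cont_1 contw]
          continuous_on_compose2[OF cont_i contw] continuous_on_compose2[OF contF contw] contw)
        (auto simp: zero_iff)
    then obtain K where K: "\<And>s. (K has_vector_derivative k s) (at s)"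
      using continuous_imp_antiderivative by blast
    \<comment> \<open>\<open>\<Psi>\<close> is only known to be continuous. Up to a constant, the
      differentiable \<open>K\<close> is another logarithm of the field along the ray, so the
      difference \<open>h\<close> is constant and \<open>\<Psi>\<close> inherits the monotonicity of
      \<open>K\<close>.\<close>
    define h where "h s = \<Psi> (Complex s \<theta>) - K s" for s
    have "exp (h s) = exp (h 0)" for s
    proof -
      have "exp (\<Psi> (Complex s \<theta>)) = exp (\<Psi> (Complex 0 \<theta>)) * exp (K s - K 0)"
        using linear_ode_solution[OF Fw K, of s 0] by (simp add: w_def \<Psi>(2))
      then show ?thesis by (simp add: h_def exp_diff)
    qed
    moreover have "continuous_on UNIV h"
    proof -
      have "continuous_on UNIV (\<lambda>s. \<Psi> (Complex s \<theta>))"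
        by (rule continuous_on_compose2[OF \<Psi>(1)]) (auto intro!: continuous_intros simp: Complex_eq)
      moreover have "continuous_on UNIV K"
        using K by (meson continuous_at_imp_continuous_on has_vector_derivative_continuous)
      ultimately show ?thesis unfolding h_def by (intro continuous_intros)
    qed
    ultimately have "h s = h t"
      using continuous_exp_constant[of h] by metis
    moreover have "Im (K s) \<le> Im (K t)"
    proof (rule DERIV_nonneg_imp_nondecreasing[OF that])
      fix x
      have "Im (k x) \<ge> 0"
        using turning[of "w x"] by (simp add: k_def complex_div_cnj[of "DF (w x) (w x)"] mult.commute)
      moreover have "((\<lambda>s. Im (K s)) has_real_derivative Im (k x)) (at x)"
        using K[of x] by (simp add: has_vector_derivative_complex_iff)
      ultimately show "\<exists>y. ((\<lambda>s. Im (K s)) has_real_derivative y) (at x) \<and> 0 \<le> y" by blast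
    qed
    ultimately show ?thesis by (simp add: h_def complex_eq_iff)
  qed
  with \<Psi> that show ?thesis by blast
qed

end

section \<open>Comparing two closed orbits\<close>

lemma polar_curve_exp_ray:
  "exp (Complex (a + b) \<theta>) = of_real (exp b) * exp (Complex a \<theta>)"
proof -
  have "Complex (a + b) \<theta> = of_real b + Complex a \<theta>"
    by (simp add: complex_eq_iff)
  then show ?thesis by (simp only: exp_add exp_of_real)
qed

section \<open>Distinct closed orbits as disjoint graphs over the angle\<close>

context radially_turning_field
begin

lemma distinct_closed_orbits_polar:
  assumes c: "closed_orbit F c p" and d: "closed_orbit F d q" and ne: "range c \<noteq> range d"
  obtains u v P where "P > 0" "\<And>\<theta>. u (\<theta> + P) = u \<theta>" "\<And>\<theta>. v (\<theta> + P) = v \<theta>"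
    "\<And>\<theta>. u \<theta> \<noteq> v \<theta>"
    "range c = range (\<lambda>\<theta>. exp (Complex (u \<theta>) \<theta>))" "range d = range (\<lambda>\<theta>. exp (Complex (v \<theta>) \<theta>))"
    "\<And>\<theta> w. w = exp (Complex (u \<theta>) \<theta>) \<Longrightarrow> (u has_real_derivative Re (F w / w) / Im (F w / w)) (at \<theta>)"
    "\<And>\<theta> w. w = exp (Complex (v \<theta>) \<theta>) \<Longrightarrow> (v has_real_derivative Re (F w / w) / Im (F w / w)) (at \<theta>)"
proof -
  obtain u n where u: "n > 0" "\<And>\<theta>. u (\<theta> + real n * (2 * pi)) = u \<theta>"
    "range c = range (\<lambda>\<theta>. exp (Complex (u \<theta>) \<theta>))"
    "\<And>\<theta> w. w = exp (Complex (u \<theta>) \<theta>) \<Longrightarrow> (u has_real_derivative Re (F w / w) / Im (F w / w)) (at \<theta>)"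
    by (rule closed_orbit_polar_form[OF c]) (rule that; assumption)
  obtain v m where v: "m > 0" "\<And>\<theta>. v (\<theta> + real m * (2 * pi)) = v \<theta>"
    "range d = range (\<lambda>\<theta>. exp (Complex (v \<theta>) \<theta>))"
    "\<And>\<theta> w. w = exp (Complex (v \<theta>) \<theta>) \<Longrightarrow> (v has_real_derivative Re (F w / w) / Im (F w / w)) (at \<theta>)"
    by (rule closed_orbit_polar_form[OF d]) (rule that; assumption)
  \<comment> \<open>The graphs close up after \<open>n\<close> and \<open>m\<close> turns, so
    \<open>m * n\<close> turns are a common period.\<close>
  define P where "P = real m * (real n * (2 * pi))"
  have P': "P = real n * (real m * (2 * pi))" by (simp add: P_def)
  show ?thesis
  proof (rule that[of P u v])
    show "P > 0" using u(1) v(1) by (simp add: P_def)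
    show "u (\<theta> + P) = u \<theta>" for \<theta>
      unfolding P_def by (rule periodic_multiple[of u "real n * (2 * pi)", OF u(2)])
    show "v (\<theta> + P) = v \<theta>" for \<theta>
      unfolding P' by (rule periodic_multiple[of v "real m * (2 * pi)", OF v(2)])
    show "u \<theta> \<noteq> v \<theta>" for \<theta>
    proof
      assume "u \<theta> = v \<theta>"
      moreover have "exp (Complex (u \<theta>) \<theta>) \<in> range c" "exp (Complex (v \<theta>) \<theta>) \<in> range d"
        unfolding u(3) v(3) by (rule rangeI)+
      ultimately have "range c \<inter> range d \<noteq> {}" by auto
      then show False using closed_orbits_meet_imp_eq[OF c d] ne by blast
    qed
  qed (use u(3,4) v(3,4) in auto)
qed

lemma closed_orbit_Im_nonzero:
  assumes c: "closed_orbit F c p" and "w \<in> range c"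
  shows "w \<noteq> 0" "Im (F w / w) \<noteq> 0"
  using assms closed_orbit_rotates[OF c] closed_orbit_nonzero[OF c] by (auto, metis less_irrefl)+

text \<open>At a critical point of the difference of the graphs the slopes agree, so the field is
  parallel at two points of one ray. This contradicts condition (1).\<close>

lemma distinct_closed_orbits_parallel:
  assumes c: "closed_orbit F c p" and d: "closed_orbit F d q" and ne: "range c \<noteq> range d"
  obtains w \<tau> where "w \<noteq> 0" "\<tau> > 0" "\<tau> \<noteq> 1" "Im (cnj (F w) * F (of_real \<tau> * w)) = 0"
proof -
  obtain u v P where uv: "P > 0" "\<And>\<theta>. u (\<theta> + P) = u \<theta>" "\<And>\<theta>. v (\<theta> + P) = v \<theta>"
    "\<And>\<theta>. u \<theta> \<noteq> v \<theta>"
    "range c = range (\<lambda>\<theta>. exp (Complex (u \<theta>) \<theta>))" "range d = range (\<lambda>\<theta>. exp (Complex (v \<theta>) \<theta>))"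
    "\<And>\<theta> w. w = exp (Complex (u \<theta>) \<theta>) \<Longrightarrow> (u has_real_derivative Re (F w / w) / Im (F w / w)) (at \<theta>)"
    "\<And>\<theta> w. w = exp (Complex (v \<theta>) \<theta>) \<Longrightarrow> (v has_real_derivative Re (F w / w) / Im (F w / w)) (at \<theta>)"
    by (rule distinct_closed_orbits_polar[OF c d ne]) (rule that; assumption)
  define D where "D \<theta> = v \<theta> - u \<theta>" for \<theta>
  have D: "(D has_real_derivative Re (F w' / w') / Im (F w' / w') - Re (F w / w) / Im (F w / w)) (at \<theta>)"
    if "w = exp (Complex (u \<theta>) \<theta>)" "w' = exp (Complex (v \<theta>) \<theta>)" for w w' \<theta>
    unfolding D_def[abs_def] by (intro derivative_intros uv(7,8) that)
  have "D 0 = D P" using uv(2,3)[of 0] by (simp add: D_def)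
  moreover have "D differentiable (at \<theta>)" "isCont D \<theta>" for \<theta>
    using D[OF refl refl, of \<theta>] by (auto intro: DERIV_isCont simp: real_differentiable_def)
  ultimately obtain \<theta> where \<theta>: "(D has_real_derivative 0) (at \<theta>)"
    using Rolle[OF uv(1), of D] continuous_at_imp_continuous_on by blast
  define w where "w = exp (Complex (u \<theta>) \<theta>)"
  \<comment> \<open>The ratio of the two radii on the ray at angle \<open>\<theta>\<close>; it is
    not 1 because the graphs do not meet.\<close>
  define \<tau> where "\<tau> = exp (D \<theta>)"
  have w': "exp (Complex (v \<theta>) \<theta>) = of_real \<tau> * w"
    using polar_curve_exp_ray[of "u \<theta>" "D \<theta>" \<theta>] by (simp add: D_def \<tau>_def w_def)
  define a b where "a = F w / w" and "b = F (of_real \<tau> * w) / (of_real \<tau> * w)"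
  have "Re b / Im b - Re a / Im a = 0"
    using DERIV_unique[OF D[OF w_def w'[symmetric]] \<theta>] by (simp add: a_def b_def)
  moreover have nz: "Im a \<noteq> 0" "Im b \<noteq> 0"
    unfolding a_def b_def
    by (rule closed_orbit_Im_nonzero(2)[OF c], simp add: uv(5) w_def,
        rule closed_orbit_Im_nonzero(2)[OF d], unfold uv(6) w'[symmetric], rule rangeI)
  ultimately have "Im (cnj a * b) = 0"
    using cot_difference[OF nz] by simp
  moreover have "cnj (F w) * F (of_real \<tau> * w) = of_real (\<tau> * (norm w)\<^sup>2) * (cnj a * b)"
  proof -
    have "F w = a * w" "F (of_real \<tau> * w) = b * (of_real \<tau> * w)"
      by (simp_all add: a_def b_def w_def \<tau>_def)
    moreover have "of_real ((norm w)\<^sup>2) = w * cnj w"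
      using complex_norm_square[of w] by simp
    ultimately show ?thesis by simp
  qed
  moreover have "Im (of_real x * z) = x * Im z" for x z by simp
  ultimately have "Im (cnj (F w) * F (of_real \<tau> * w)) = 0"
    by (simp only: mult_zero_right)
  moreover have "\<tau> \<noteq> 1" "\<tau> > 0"
    using uv(4)[of \<theta>] by (auto simp: \<tau>_def D_def)
  ultimately show ?thesis
    using that[of w \<tau>] by (simp add: w_def)
qed

section \<open>Scaled copies of a closed orbit and isolation\<close>

lemma scaled_closed_orbit:
  assumes c: "closed_orbit F c p" and "\<kappa> > 0"
    and dir: "\<And>w. w \<in> range c \<Longrightarrow> \<exists>r>0. F (of_real \<kappa> * w) = of_real r * F w"
  obtains d q where "closed_orbit F d q" "range d = (\<lambda>w. of_real \<kappa> * w) ` range c"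
proof -
  note cD = closed_orbitD[OF c]
  have contc: "continuous_on UNIV c"
    using solution_continuous cD(2) by blast
  have nz: "F (c t) \<noteq> 0" "F (of_real \<kappa> * c t) \<noteq> 0" for t
    using closed_orbit_nonzero[OF c] \<open>\<kappa> > 0\<close> by (auto simp: zero_iff)
  \<comment> \<open>The scaled curve has velocity \<open>\<kappa>\<close> times
    \<open>F (c t)\<close>, which points in the direction of the field there; \<open>k\<close> is
    the quotient of their lengths.\<close>
  define k where "k t = \<kappa> * norm (F (c t)) / norm (F (of_real \<kappa> * c t))" for t
  define e where "e t = of_real \<kappa> * c t" for t
  have "(e has_vector_derivative k t *\<^sub>R F (e t)) (at t)" for t
  proof -
    obtain r where r: "r > 0" "F (of_real \<kappa> * c t) = of_real r * F (c t)"
      using dir by blast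
    have "(e has_vector_derivative of_real \<kappa> * F (c t)) (at t)"
      unfolding e_def[abs_def] by (intro derivative_intros cD(2))
    moreover have "k t *\<^sub>R F (e t) = of_real \<kappa> * F (c t)"
      using r nz(1)[of t] by (simp add: k_def e_def norm_mult scaleR_conv_of_real)
    ultimately show ?thesis by simp
  qed
  moreover have "continuous_on UNIV k"
    unfolding k_def using nz
    by (intro continuous_intros continuous_on_compose2[OF contF[of UNIV]] contc) auto
  moreover have "k t > 0" "k (t + p) = k t" "e (t + p) = e t" for t
    using nz[of t] \<open>\<kappa> > 0\<close> cD(3) by (simp_all add: k_def e_def)
  moreover have "\<exists>t. e t \<noteq> e 0"
    using cD(4) \<open>\<kappa> > 0\<close> by (simp add: e_def)
  moreover have "range e = (\<lambda>w. of_real \<kappa> * w) ` range c"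
    by (auto simp: e_def)
  ultimately show ?thesis
    using closed_orbit_reparametrize[of e k F p thesis] cD(1) that by metis
qed

text \<open>A slightly enlarged copy is a closed orbit inside \<open>U\<close>, so it would equal
  the orbit itself; but enlarging moves the point farthest from the origin farther out.\<close>

lemma isolated_closed_orbit_not_scalable:
  assumes c: "closed_orbit F c p"
    and U: "open U" "range c \<subseteq> U"
    and iso: "\<And>d q. closed_orbit F d q \<Longrightarrow> range d \<subseteq> U \<Longrightarrow> range d = range c"
    and "\<mu> > 1"
    and dir: "\<And>w \<kappa>. w \<in> range c \<Longrightarrow> 1 \<le> \<kappa> \<Longrightarrow> \<kappa> \<le> \<mu> \<Longrightarrow> \<exists>r>0. F (of_real \<kappa> * w) = of_real r * F w"
  shows False
proof -
  have cpt: "compact (range c)" by (rule closed_orbit_compact[OF c])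
  obtain \<epsilon> where \<epsilon>: "\<epsilon> > 0" "(\<Union>x\<in>range c. ball x \<epsilon>) \<subseteq> U"
    using compact_subset_open_imp_ball_epsilon_subset[OF cpt U] .
  obtain R where R: "R > 0" "\<And>w. w \<in> range c \<Longrightarrow> norm w \<le> R"
    using compact_imp_bounded[OF cpt] unfolding bounded_pos by blast
  \<comment> \<open>Scaling by this factor moves points of norm at most \<open>R\<close> by at most
    \<open>\<epsilon> / 2\<close>.\<close>
  define \<kappa> where "\<kappa> = min \<mu> (1 + \<epsilon> / (2 * R))"
  have \<kappa>: "\<kappa> > 1" "\<kappa> \<le> \<mu>" "(\<kappa> - 1) * R \<le> \<epsilon> / 2"
    using \<open>\<mu> > 1\<close> R \<epsilon>(1) by (auto simp: \<kappa>_def min_def field_simps)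
  obtain d q where d: "closed_orbit F d q" "range d = (\<lambda>w. of_real \<kappa> * w) ` range c"
    using scaled_closed_orbit[OF c, of \<kappa>] dir \<kappa> by (metis less_imp_le less_trans zero_less_one)
  have "of_real \<kappa> * w \<in> ball w \<epsilon>" if "w \<in> range c" for w
  proof -
    have "norm (w - of_real \<kappa> * w) = (\<kappa> - 1) * norm w"
    proof -
      have "w - of_real \<kappa> * w = of_real (1 - \<kappa>) * w" by (simp add: algebra_simps)
      then have "norm (w - of_real \<kappa> * w) = \<bar>1 - \<kappa>\<bar> * norm w"
        by (simp only: norm_mult norm_of_real)
      then show ?thesis using \<kappa>(1) by simp
    qed
    also have "\<dots> \<le> (\<kappa> - 1) * R"
      using R(2)[OF that] \<kappa>(1) by (intro mult_left_mono) auto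
    finally show ?thesis using \<kappa>(3) \<epsilon>(1) by (simp add: dist_norm)
  qed
  then have "range d \<subseteq> U"
    unfolding d(2) using \<epsilon>(2) by blast
  with iso d have eq: "(\<lambda>w. of_real \<kappa> * w) ` range c = range c" by metis
  obtain w where w: "w \<in> range c" "\<And>y. y \<in> range c \<Longrightarrow> norm y \<le> norm w"
    using continuous_attains_sup[OF cpt, of norm] continuous_on_norm_id by auto
  have "of_real \<kappa> * w \<in> range c" using eq w(1) by blast
  from w(2)[OF this] have "\<kappa> * norm w \<le> norm w"
    using \<kappa>(1) by (simp add: norm_mult)
  moreover have "norm w > 0"
    using closed_orbit_Im_nonzero[OF c w(1)] by simp
  ultimately show False using \<kappa>(1) by simp
qed

end

section \<open>Uniqueness of isolated closed orbits under condition (2)\<close>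

context radially_turning_field
begin

lemma nested_closed_orbits_scalable:
  fixes \<eta> :: "real \<Rightarrow> complex"
  assumes c: "closed_orbit F c p" and d: "closed_orbit F d q"
    and P: "P > 0" "\<And>\<theta>. u (\<theta> + P) = u \<theta>" "\<And>\<theta>. v (\<theta> + P) = v \<theta>"
    and less: "\<And>\<theta>. u \<theta> < v \<theta>"
    and ranges: "range c = range (\<lambda>\<theta>. exp (Complex (u \<theta>) \<theta>))"
      "range d = range (\<lambda>\<theta>. exp (Complex (v \<theta>) \<theta>))"
    and slope_u: "\<And>\<theta> w. w = exp (Complex (u \<theta>) \<theta>) \<Longrightarrow> (u has_real_derivative Re (F w / w) / Im (F w / w)) (at \<theta>)"
    and slope_v: "\<And>\<theta> w. w = exp (Complex (v \<theta>) \<theta>) \<Longrightarrow> (v has_real_derivative Re (F w / w) / Im (F w / w)) (at \<theta>)"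
    and I: "convex I" and \<eta>: "continuous_on I \<eta>"
    and \<eta>_pos: "\<And>s. s \<in> I \<Longrightarrow> Im (F (\<eta> s) / \<eta> s) > 0"
    and small: "\<And>e. e > 0 \<Longrightarrow> \<exists>s\<in>I. norm (\<eta> s) < e"
    and large: "\<And>R. \<exists>s\<in>I. norm (\<eta> s) > R"
  obtains \<mu> where "\<mu> > 1"
    "\<And>w \<kappa>. w \<in> range c \<Longrightarrow> 1 \<le> \<kappa> \<Longrightarrow> \<kappa> \<le> \<mu> \<Longrightarrow> \<exists>r>0. F (of_real \<kappa> * w) = of_real r * F w"
proof -
  obtain \<Psi> where \<Psi>: "continuous_on UNIV \<Psi>" "\<And>\<zeta>. F (exp \<zeta>) = exp (\<Psi> \<zeta>)"
    "\<And>s t \<theta>. s \<le> t \<Longrightarrow> Im (\<Psi> (Complex s \<theta>)) \<le> Im (\<Psi> (Complex t \<theta>))"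
    by (rule direction_lift) (rule that; assumption)
  \<comment> \<open>The lifted angle from the position to the field, in coordinates \<zeta> = ln r +
    i \<theta>. Its sine has the sign of the angular speed.\<close>
  define \<phi> where "\<phi> \<zeta> = Im (\<Psi> \<zeta> - \<zeta>)" for \<zeta>
  have cont_\<phi>: "continuous_on S \<phi>" for S
    unfolding \<phi>_def by (intro continuous_intros continuous_on_subset[OF \<Psi>(1)]) auto
  have quot: "F (exp \<zeta>) / exp \<zeta> = exp (\<Psi> \<zeta> - \<zeta>)" for \<zeta>
    by (simp add: \<Psi>(2) exp_diff)
  have Im_quot: "Im (F (exp \<zeta>) / exp \<zeta>) = exp (Re (\<Psi> \<zeta> - \<zeta>)) * sin (\<phi> \<zeta>)" for \<zeta>
    unfolding quot \<phi>_def by (rule Im_exp)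

  have cont_uv: "continuous_on S u" "continuous_on S v" for S
    using slope_u[OF refl] slope_v[OF refl] DERIV_isCont continuous_at_imp_continuous_on by metis+

  have "\<eta> s \<noteq> 0" if "s \<in> I" for s
    using \<eta>_pos[OF that] by auto
  then obtain L where L: "continuous_on I L" "\<And>s. s \<in> I \<Longrightarrow> \<eta> s = exp (L s)"
    using continuous_logarithm_on_contractible[OF \<eta> convex_imp_contractible[OF I]] by metis
  \<comment> \<open>The lifted transversal \<open>L\<close> has real part below the bounded periodic
    \<open>f\<close> near the origin and above it far out. Connectedness of \<open>I\<close> gives a
    crossing with the graph of \<open>f\<close>.\<close>
  have meets: "\<exists>s\<in>I. L s = Complex (f (Im (L s))) (Im (L s))"
    if f: "continuous_on UNIV f" "\<And>\<theta>. f (\<theta> + P) = f \<theta>" for f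
  proof -
    have "compact (range f)"
      using range_periodic[of f P, OF f(2) P(1)] compact_continuous_image[OF continuous_on_subset[OF f(1)] compact_Icc]
      by (metis subset_UNIV)
    then have "bounded (range f)" by (rule compact_imp_bounded)
    then obtain M where M: "\<And>\<theta>. \<bar>f \<theta>\<bar> \<le> M"
      unfolding bounded_iff by auto
    define g where "g s = Re (L s) - f (Im (L s))" for s
    have "continuous_on I (\<lambda>s. f (Im (L s)))"
      by (rule continuous_on_compose2[OF f(1)]) (auto intro!: continuous_intros L(1))
    then have "continuous_on I g"
      unfolding g_def by (intro continuous_intros L(1))
    then have conn: "connected (g ` I)"
      by (rule connected_continuous_image) (rule convex_connected[OF I])
    obtain s1 where s1: "s1 \<in> I" "norm (\<eta> s1) < exp (- M)"
      using small[of "exp (- M)"] by auto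
    obtain s2 where s2: "s2 \<in> I" "norm (\<eta> s2) > exp M"
      using large by blast
    have "g s1 \<le> 0" "0 \<le> g s2"
      using s1(2) s2(2) M[of "Im (L s1)"] M[of "Im (L s2)"]
      unfolding L(2)[OF s1(1)] L(2)[OF s2(1)] by (auto simp: g_def)
    then have "0 \<in> g ` I"
      using connected_contains_Icc[OF conn, of "g s1" "g s2"] s1(1) s2(1) by auto
    then show ?thesis by (auto simp: g_def complex_eq_iff)
  qed

  define Cu where "Cu = range (\<lambda>\<theta>. Complex (u \<theta>) \<theta>)"
  define Cv where "Cv = range (\<lambda>\<theta>. Complex (v \<theta>) \<theta>)"
  have conn: "connected Cu" "connected Cv" "connected (L ` I)"
    unfolding Cu_def Cv_def using convex_connected[OF I] L(1)
    by (auto intro!: connected_continuous_image continuous_intros cont_uv)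
  have "Cu \<inter> L ` I \<noteq> {}" "L ` I \<inter> Cv \<noteq> {}"
    using meets[OF cont_uv(1) P(2)] meets[OF cont_uv(2) P(3)]
    unfolding Cu_def Cv_def by blast+
  with conn have conn: "connected (Cu \<union> L ` I \<union> Cv)"
    by (intro connected_Un) auto

  have sin_L: "sin (\<phi> \<zeta>) > 0" if "\<zeta> \<in> L ` I" for \<zeta>
    using that \<eta>_pos L(2) Im_quot by (force simp: zero_less_mult_iff)
  \<comment> \<open>The angular speed is positive where the orbit meets the transversal, and it has
    a constant sign along the orbit.\<close>
  have sin_curve: "sin (\<phi> \<zeta>) > 0"
    if e: "closed_orbit F e r" and rng: "range e = exp ` C" and meet: "L ` I \<inter> C \<noteq> {}" and "\<zeta> \<in> C"
    for e r C \<zeta>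
  proof -
    obtain \<xi> where \<xi>: "\<xi> \<in> C" "\<xi> \<in> L ` I" using meet by blast
    have "exp \<xi> \<in> range e" "exp \<zeta> \<in> range e" using rng \<xi> \<open>\<zeta> \<in> C\<close> by auto
    then obtain s t where st: "exp \<xi> = e s" "exp \<zeta> = e t" by auto
    have "Im (F (e s) / e s) > 0"
      using sin_L[OF \<xi>(2)] Im_quot[of \<xi>] by (simp add: st zero_less_mult_iff)
    then have "Im (F (e t) / e t) > 0"
      using closed_orbit_rotates[OF e] by (meson less_asym)
    then show ?thesis
      using Im_quot[of \<zeta>] by (simp add: st zero_less_mult_iff)
  qed
  have sin_pos: "sin (\<phi> \<zeta>) > 0" if "\<zeta> \<in> Cu \<union> L ` I \<union> Cv" for \<zeta>
  proof -
    have "range c = exp ` Cu" "range d = exp ` Cv"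
      unfolding ranges Cu_def Cv_def by (simp_all add: image_image)
    with that show ?thesis
      using sin_curve[OF c] sin_curve[OF d] sin_L \<open>Cu \<inter> L ` I \<noteq> {}\<close> \<open>L ` I \<inter> Cv \<noteq> {}\<close>
      by (metis Int_commute Un_iff)
  qed
  \<comment> \<open>How far the field turns along the ray from the inner to the outer orbit; the
    angle of the position cancels. It is nonnegative by monotonicity of \<open>\<Psi>\<close> and
    below pi by connectedness.\<close>
  define \<delta> where "\<delta> \<theta> = \<phi> (Complex (v \<theta>) \<theta>) - \<phi> (Complex (u \<theta>) \<theta>)" for \<theta>
  have \<delta>: "0 \<le> \<delta> \<theta>" "\<delta> \<theta> < pi" for \<theta>
  proof -
    show "0 \<le> \<delta> \<theta>"
      using \<Psi>(3)[of "u \<theta>" "v \<theta>" \<theta>] less[of \<theta>] by (simp add: \<delta>_def \<phi>_def)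
    show "\<delta> \<theta> < pi"
      unfolding \<delta>_def
      by (rule connected_sin_pos[OF conn cont_\<phi> sin_pos]) (auto simp: Cu_def Cv_def)
  qed

  define D where "D \<theta> = v \<theta> - u \<theta>" for \<theta>
  define D' where "D' \<theta> = - sin (\<delta> \<theta>) / (sin (\<phi> (Complex (u \<theta>) \<theta>)) * sin (\<phi> (Complex (v \<theta>) \<theta>)))" for \<theta>
  have su: "sin (\<phi> (Complex (u \<theta>) \<theta>)) > 0" and sv: "sin (\<phi> (Complex (v \<theta>) \<theta>)) > 0" for \<theta>
    by (rule sin_pos; simp add: Cu_def Cv_def)+
  have cot: "Re (F (exp \<zeta>) / exp \<zeta>) / Im (F (exp \<zeta>) / exp \<zeta>) = cos (\<phi> \<zeta>) / sin (\<phi> \<zeta>)" for \<zeta>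
    unfolding quot \<phi>_def by (simp add: Re_exp Im_exp)
  have D: "(D has_real_derivative D' \<theta>) (at \<theta>)" for \<theta>
  proof -
    have "(D has_real_derivative cos (\<phi> (Complex (v \<theta>) \<theta>)) / sin (\<phi> (Complex (v \<theta>) \<theta>))
        - cos (\<phi> (Complex (u \<theta>) \<theta>)) / sin (\<phi> (Complex (u \<theta>) \<theta>))) (at \<theta>)"
      unfolding D_def[abs_def] cot[symmetric]
      by (intro derivative_intros slope_u slope_v refl)
    moreover have "cos (\<phi> (Complex (v \<theta>) \<theta>)) / sin (\<phi> (Complex (v \<theta>) \<theta>))
        - cos (\<phi> (Complex (u \<theta>) \<theta>)) / sin (\<phi> (Complex (u \<theta>) \<theta>)) = D' \<theta>"
      using su[of \<theta>] sv[of \<theta>] by (simp add: D'_def \<delta>_def sin_diff field_simps)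
    ultimately show ?thesis by simp
  qed
  have "antimono D"
  proof (rule antimonoI)
    fix x y :: real
    assume "x \<le> y"
    then show "D y \<le> D x"
    proof (rule DERIV_nonpos_imp_nonincreasing)
      fix \<theta>
      have "D' \<theta> \<le> 0"
        using \<delta>[of \<theta>] su[of \<theta>] sv[of \<theta>] sin_ge_zero[of "\<delta> \<theta>"]
        by (simp add: D'_def)
      then show "\<exists>y. (D has_real_derivative y) (at \<theta>) \<and> y \<le> 0"
        using D by blast
    qed
  qed
  then have const: "D \<theta> = D 0" for \<theta>
    using periodic_antimono_imp_constant[of D P] P by (simp add: D_def)
  \<comment> \<open>A constant \<open>D\<close> forces \<open>sin (\<delta> \<theta>) = 0\<close>,
    and the bounds on \<open>\<delta>\<close> leave only 0.\<close>
  have \<delta>0: "\<delta> \<theta> = 0" for \<theta>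
  proof -
    have "D = (\<lambda>_. D 0)" using const by blast
    then have "(D has_real_derivative 0) (at \<theta>)" by (metis DERIV_const)
    with D have "D' \<theta> = 0" using DERIV_unique by blast
    then have "sin (\<delta> \<theta>) = 0"
      using su[of \<theta>] sv[of \<theta>] by (simp add: D'_def)
    then show ?thesis
      using \<delta>[of \<theta>] sin_gt_zero[of "\<delta> \<theta>"] by linarith
  qed
  show ?thesis
  proof
    \<comment> \<open>\<open>exp (D 0)\<close> is the constant ratio of the outer to the inner
      radius.\<close>
    show "exp (D 0) > 1" using less[of 0] by (simp add: D_def)
    fix w \<kappa>
    assume "w \<in> range c" and \<kappa>: "1 \<le> \<kappa>" "\<kappa> \<le> exp (D 0)"
    then obtain \<theta> where w: "w = exp (Complex (u \<theta>) \<theta>)" unfolding ranges by blast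
    define e where "e = ln \<kappa>"
    have e: "\<kappa> = exp e" "0 \<le> e" "e \<le> D \<theta>"
      using \<kappa> const[of \<theta>] ln_le_cancel_iff[of \<kappa> "exp (D 0)"] by (auto simp: e_def)
    define z where "z = \<Psi> (Complex (u \<theta> + e) \<theta>) - \<Psi> (Complex (u \<theta>) \<theta>)"
    \<comment> \<open>The argument of the field is monotone along the ray and equal at both ends,
      hence constant in between.\<close>
    have "Im (\<Psi> (Complex (u \<theta>) \<theta>)) \<le> Im (\<Psi> (Complex (u \<theta> + e) \<theta>))"
      "Im (\<Psi> (Complex (u \<theta> + e) \<theta>)) \<le> Im (\<Psi> (Complex (v \<theta>) \<theta>))"
      using e by (auto intro!: \<Psi>(3) simp: D_def)
    moreover have "Im (\<Psi> (Complex (v \<theta>) \<theta>)) = Im (\<Psi> (Complex (u \<theta>) \<theta>))"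
      using \<delta>0[of \<theta>] by (simp add: \<delta>_def \<phi>_def)
    ultimately have "Im z = 0" by (simp add: z_def)
    then have "z = of_real (Re z)" by (simp add: complex_eq_iff)
    then have z: "exp z = of_real (exp (Re z))" by (metis exp_of_real)
    have "F (of_real \<kappa> * w) = exp (\<Psi> (Complex (u \<theta> + e) \<theta>))"
      unfolding e(1) w polar_curve_exp_ray[symmetric] by (rule \<Psi>(2))
    also have "\<dots> = exp z * F w"
      unfolding w \<Psi>(2) by (simp add: z_def exp_diff)
    finally show "\<exists>r>0. F (of_real \<kappa> * w) = of_real r * F w"
      unfolding z by (intro exI[of _ "exp (Re z)"]) simp
  qed
qed

text \<open>Graphs that never meet are ordered the same way at every angle. Whichever orbit is the
  inner one can be enlarged to nearby closed orbits and so fails to be isolated.\<close>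

lemma isolated_closed_orbit_unique_pos:
  fixes \<eta> :: "real \<Rightarrow> complex"
  assumes c: "closed_orbit F c p" and d: "closed_orbit F d q"
    and c_iso: "open U" "range c \<subseteq> U" "\<And>e r. closed_orbit F e r \<Longrightarrow> range e \<subseteq> U \<Longrightarrow> range e = range c"
    and d_iso: "open V" "range d \<subseteq> V" "\<And>e r. closed_orbit F e r \<Longrightarrow> range e \<subseteq> V \<Longrightarrow> range e = range d"
    and I: "convex I" and \<eta>: "continuous_on I \<eta>"
    and \<eta>_pos: "\<And>s. s \<in> I \<Longrightarrow> Im (F (\<eta> s) / \<eta> s) > 0"
    and small: "\<And>e. e > 0 \<Longrightarrow> \<exists>s\<in>I. norm (\<eta> s) < e"
    and large: "\<And>R. \<exists>s\<in>I. norm (\<eta> s) > R"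
  shows "range c = range d"
proof (rule ccontr)
  assume ne: "range c \<noteq> range d"
  obtain u v P where uv: "P > 0" "\<And>\<theta>. u (\<theta> + P) = u \<theta>" "\<And>\<theta>. v (\<theta> + P) = v \<theta>"
    "\<And>\<theta>. u \<theta> \<noteq> v \<theta>"
    "range c = range (\<lambda>\<theta>. exp (Complex (u \<theta>) \<theta>))" "range d = range (\<lambda>\<theta>. exp (Complex (v \<theta>) \<theta>))"
    "\<And>\<theta> w. w = exp (Complex (u \<theta>) \<theta>) \<Longrightarrow> (u has_real_derivative Re (F w / w) / Im (F w / w)) (at \<theta>)"
    "\<And>\<theta> w. w = exp (Complex (v \<theta>) \<theta>) \<Longrightarrow> (v has_real_derivative Re (F w / w) / Im (F w / w)) (at \<theta>)"
    by (rule distinct_closed_orbits_polar[OF c d ne]) (rule that; assumption)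
  have "continuous_on UNIV u" "continuous_on UNIV v"
    using uv(7,8)[OF refl] DERIV_isCont continuous_at_imp_continuous_on by metis+
  then have conn: "connected (range (\<lambda>\<theta>. v \<theta> - u \<theta>))"
    by (intro connected_continuous_image continuous_intros) auto
  have "(\<forall>\<theta>. u \<theta> < v \<theta>) \<or> (\<forall>\<theta>. v \<theta> < u \<theta>)"
  proof (rule ccontr)
    assume "\<not> ?thesis"
    then obtain s t where "v s \<le> u s" "u t \<le> v t"
      by (meson not_less)
    then have "0 \<in> range (\<lambda>\<theta>. v \<theta> - u \<theta>)"
      using connected_contains_Icc[OF conn, of "v s - u s" "v t - u t"] by auto
    then obtain r where "v r - u r = 0" by auto
    then show False using uv(4)[of r] by simp
  qed
  then show False
  proof
    assume less: "\<forall>\<theta>. u \<theta> < v \<theta>"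
    obtain \<mu> where \<mu>: "\<mu> > 1"
      "\<And>w \<kappa>. w \<in> range c \<Longrightarrow> 1 \<le> \<kappa> \<Longrightarrow> \<kappa> \<le> \<mu> \<Longrightarrow> \<exists>r>0. F (of_real \<kappa> * w) = of_real r * F w"
      by (rule nested_closed_orbits_scalable[OF c d uv(1-3) less[rule_format] uv(5-8) I \<eta> \<eta>_pos small large])
        ((assumption | (rule that; assumption))+)
    show False by (rule isolated_closed_orbit_not_scalable[OF c c_iso \<mu>])
  next
    assume less: "\<forall>\<theta>. v \<theta> < u \<theta>"
    obtain \<mu> where \<mu>: "\<mu> > 1"
      "\<And>w \<kappa>. w \<in> range d \<Longrightarrow> 1 \<le> \<kappa> \<Longrightarrow> \<kappa> \<le> \<mu> \<Longrightarrow> \<exists>r>0. F (of_real \<kappa> * w) = of_real r * F w"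
      by (rule nested_closed_orbits_scalable[OF d c uv(1,3,2) less[rule_format] uv(6,5,8,7) I \<eta> \<eta>_pos small large])
        ((assumption | (rule that; assumption))+)
    show False by (rule isolated_closed_orbit_not_scalable[OF d d_iso \<mu>])
  qed
qed

end

text \<open>Replacing \<open>F\<close> by \<open>- F\<close> reverses the sign of rotation. It keeps
  the traces of closed orbits, and also \<alpha>, which is quadratic in the field.\<close>

lemma isolated_closed_orbit_unique_signed:
  fixes F :: "complex \<Rightarrow> complex" and \<eta> :: "real \<Rightarrow> complex"
  assumes F: "radially_turning_field F DF"
    and c: "closed_orbit F c p" and d: "closed_orbit F d q"
    and c_iso: "open U" "range c \<subseteq> U" "\<And>e r. closed_orbit F e r \<Longrightarrow> range e \<subseteq> U \<Longrightarrow> range e = range c"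
    and d_iso: "open V" "range d \<subseteq> V" "\<And>e r. closed_orbit F e r \<Longrightarrow> range e \<subseteq> V \<Longrightarrow> range e = range d"
    and I: "convex I" and \<eta>: "continuous_on I \<eta>"
    and \<eta>_sign: "(\<forall>s\<in>I. Im (F (\<eta> s) / \<eta> s) > 0) \<or> (\<forall>s\<in>I. Im (F (\<eta> s) / \<eta> s) < 0)"
    and small: "\<And>e. e > 0 \<Longrightarrow> \<exists>s\<in>I. norm (\<eta> s) < e"
    and large: "\<And>R. \<exists>s\<in>I. norm (\<eta> s) > R"
  shows "range c = range d"
  using \<eta>_sign
proof
  assume "\<forall>s\<in>I. Im (F (\<eta> s) / \<eta> s) > 0"
  then have pos: "\<And>s. s \<in> I \<Longrightarrow> Im (F (\<eta> s) / \<eta> s) > 0" by blast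
  show ?thesis
    by (rule radially_turning_field.isolated_closed_orbit_unique_pos
        [OF F c d c_iso d_iso I \<eta> pos small large])
next
  assume neg: "\<forall>s\<in>I. Im (F (\<eta> s) / \<eta> s) < 0"
  interpret F: radially_turning_field F DF by (rule F)
  have rng: "range (\<lambda>t. f (- t)) = range f" for f :: "real \<Rightarrow> complex"
    using surj_uminus by (metis (no_types) image_image)
  have rev: "closed_orbit F (\<lambda>t. e (- t)) r" if "closed_orbit (\<lambda>w. - F w) e r" for e r
    using closed_orbit_reverse[OF that] by simp
  have "radially_turning_field (\<lambda>w. - F w) (\<lambda>w v. - DF w v)"
  proof
    show "0 \<le> Im (cnj (- F w) * - DF w w)" for w
      using F.turning[of w] by (simp only: complex_cnj_minus minus_mult_minus)
  qed (auto intro!: derivative_intros continuous_intros F.deriv F.cont_1 F.cont_i simp: F.zero_iff)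
  then interpret neg: radially_turning_field "\<lambda>w. - F w" "\<lambda>w v. - DF w v" .
  have "range (\<lambda>t. c (- t)) = range (\<lambda>t. d (- t))"
  proof (rule neg.isolated_closed_orbit_unique_pos[OF closed_orbit_reverse[OF c] closed_orbit_reverse[OF d]])
    fix e r assume e: "closed_orbit (\<lambda>w. - F w) e r"
    show "range e = range (\<lambda>t. c (- t))" if "range e \<subseteq> U"
      using c_iso(3)[OF rev[OF e]] that by (simp add: rng)
    show "range e = range (\<lambda>t. d (- t))" if "range e \<subseteq> V"
      using d_iso(3)[OF rev[OF e]] that by (simp add: rng)
  next
    show "Im (- F (\<eta> s) / \<eta> s) > 0" if "s \<in> I" for s
      using neg that by simp
  qed (use c_iso d_iso I \<eta> small large in \<open>simp_all add: rng\<close>)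
  then show ?thesis by (simp add: rng)
qed

section \<open>Transfer to the real plane\<close>

definition complex_of_pair :: "real \<times> real \<Rightarrow> complex" where
  "complex_of_pair z = Complex (fst z) (snd z)"

definition pair_of_complex :: "complex \<Rightarrow> real \<times> real" where
  "pair_of_complex w = (Re w, Im w)"

lemma pair_complex_inverse [simp]:
  "pair_of_complex (complex_of_pair z) = z" "complex_of_pair (pair_of_complex w) = w"
  by (simp_all add: pair_of_complex_def complex_of_pair_def)

lemma bounded_linear_pair_of_complex: "bounded_linear pair_of_complex"
  unfolding pair_of_complex_def[abs_def]
  by (intro bounded_linear_Pair bounded_linear_Re bounded_linear_Im)

lemma bounded_linear_complex_of_pair: "bounded_linear complex_of_pair"
  unfolding complex_of_pair_def[abs_def] Complex_eq
  by (intro bounded_linear_intros bounded_linear_add bounded_linear_compose[OF bounded_linear_mult_right]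
      bounded_linear_compose[OF bounded_linear_of_real])

lemma norm_complex_of_pair: "norm (complex_of_pair z) = norm z"
  by (cases z) (simp add: complex_of_pair_def norm_Pair cmod_def)

text \<open>Differentiability makes the restrictions to coordinate lines differentiable, so the
  \<open>deriv\<close> in the partial derivatives takes the true values \<open>f' (1, 0)\<close> and
  \<open>f' (0, 1)\<close>.\<close>

lemma C1_plane_has_derivative:
  assumes "C1_plane f"
  shows "(f has_derivative (\<lambda>h. fst h * partial_x f z + snd h * partial_y f z)) (at z)"
proof -
  obtain f' where f': "(f has_derivative f') (at z)"
    using assms unfolding C1_plane_def differentiable_def by blast
  interpret linear f' using f' has_derivative_linear by blast
  have f'_z: "(f has_derivative f') (at (fst z, snd z))" using f' by simp
  have "((\<lambda>t. (t, snd z)) has_derivative (\<lambda>h. (h, 0))) (at (fst z))"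
    "((\<lambda>t. (fst z, t)) has_derivative (\<lambda>h. (0, h))) (at (snd z))"
    by (auto intro!: derivative_eq_intros)
  then have "((\<lambda>t. f (t, snd z)) has_derivative (\<lambda>h. f' (h, 0))) (at (fst z))"
    "((\<lambda>t. f (fst z, t)) has_derivative (\<lambda>h. f' (0, h))) (at (snd z))"
    using has_derivative_compose[of "\<lambda>t. (t, snd z)" "\<lambda>h. (h, 0)" "fst z" UNIV f f', OF _ f'_z]
      has_derivative_compose[of "\<lambda>t. (fst z, t)" "\<lambda>h. (0, h)" "snd z" UNIV f f', OF _ f'_z]
    by blast+
  moreover have lin: "f' (h, 0) = f' (1, 0) * h" "f' (0, h) = f' (0, 1) * h" for h
    using scale[of h "(1, 0)"] scale[of h "(0, 1)"] by simp_all
  moreover have "(\<lambda>h. f' (h, 0)) = (*) (f' (1, 0))" "(\<lambda>h. f' (0, h)) = (*) (f' (0, 1))"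
    by (rule ext, rule lin)+
  ultimately have "((\<lambda>t. f (t, snd z)) has_real_derivative f' (1, 0)) (at (fst z))"
    "((\<lambda>t. f (fst z, t)) has_real_derivative f' (0, 1)) (at (snd z))"
    unfolding has_field_derivative_def by metis+
  then have pd: "partial_x f z = f' (1, 0)" "partial_y f z = f' (0, 1)"
    unfolding partial_x_def partial_y_def by (auto intro: DERIV_imp_deriv)
  have expand: "f' h = f' (1, 0) * fst h + f' (0, 1) * snd h" for h
  proof -
    have "f' h = f' (fst h, 0) + f' (0, snd h)"
      using add[of "(fst h, 0)" "(0, snd h)"] by simp
    then show ?thesis by (simp only: lin(1)[of "fst h"] lin(2)[of "snd h"])
  qed
  have "f' h = fst h * partial_x f z + snd h * partial_y f z" for h
    unfolding pd using expand[of h] by (simp only: mult.commute)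
  then have "f' = (\<lambda>h. fst h * partial_x f z + snd h * partial_y f z)" by blast
  with f' show ?thesis by simp
qed

definition complex_field :: "(real \<times> real \<Rightarrow> real) \<Rightarrow> (real \<times> real \<Rightarrow> real) \<Rightarrow> complex \<Rightarrow> complex" where
  "complex_field P Q w = Complex (P (pair_of_complex w)) (Q (pair_of_complex w))"

definition complex_field_deriv ::
  "(real \<times> real \<Rightarrow> real) \<Rightarrow> (real \<times> real \<Rightarrow> real) \<Rightarrow> complex \<Rightarrow> complex \<Rightarrow> complex" where
  "complex_field_deriv P Q w v =
     Complex (Re v * partial_x P (pair_of_complex w) + Im v * partial_y P (pair_of_complex w))
             (Re v * partial_x Q (pair_of_complex w) + Im v * partial_y Q (pair_of_complex w))"

lemma radially_turning_complex_field:
  assumes C1: "C1_plane P" "C1_plane Q"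
    and equil: "\<And>z. P z = 0 \<and> Q z = 0 \<longleftrightarrow> z = (0, 0)"
    and alpha: "\<And>z. alpha P Q z \<ge> 0"
  shows "radially_turning_field (complex_field P Q) (complex_field_deriv P Q)"
proof
  have comp: "((\<lambda>w. f (pair_of_complex w)) has_derivative
      (\<lambda>v. Re v * partial_x f (pair_of_complex w) + Im v * partial_y f (pair_of_complex w))) (at w)"
    if "C1_plane f" for f w
    using has_derivative_compose[OF bounded_linear_imp_has_derivative[OF bounded_linear_pair_of_complex]
        C1_plane_has_derivative[OF that], of w UNIV]
    by (simp add: pair_of_complex_def)
  show "(complex_field P Q has_derivative complex_field_deriv P Q w) (at w)" for w
    unfolding complex_field_def[abs_def] complex_field_deriv_def[abs_def] Complex_eq
    by (intro derivative_intros comp C1)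
  have cont: "continuous_on UNIV (\<lambda>w. g (pair_of_complex w))"
    if "continuous_on UNIV g" for g :: "real \<times> real \<Rightarrow> real"
    by (rule continuous_on_compose2[OF that linear_continuous_on[OF bounded_linear_pair_of_complex]]) simp
  show "continuous_on UNIV (\<lambda>w. complex_field_deriv P Q w 1)"
    "continuous_on UNIV (\<lambda>w. complex_field_deriv P Q w \<i>)"
    using C1 unfolding complex_field_deriv_def C1_plane_def
    by (auto intro!: continuous_intros cont)
  show "complex_field P Q w = 0 \<longleftrightarrow> w = 0" for w
    using equil[of "pair_of_complex w"] by (simp add: complex_field_def complex_eq_iff pair_of_complex_def)
  show "0 \<le> Im (cnj (complex_field P Q w) * complex_field_deriv P Q w w)" for w
    using alpha[of "pair_of_complex w"]
    by (simp add: alpha_def complex_field_def complex_field_deriv_def pair_of_complex_def)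
qed

lemma complex_field_of_pair: "complex_field P Q (complex_of_pair z) = complex_of_pair (P z, Q z)"
  by (simp add: complex_field_def complex_of_pair_def pair_of_complex_def)

lemma pair_of_complex_field:
  "pair_of_complex (complex_field P Q w) = (P (pair_of_complex w), Q (pair_of_complex w))"
  by (simp add: complex_field_def pair_of_complex_def)

section \<open>Periodic orbits and limit cycles in complex form\<close>

lemma periodic_orbit_imp_closed_orbit:
  assumes "periodic_orbit P Q \<Gamma>"
  obtains c p where "closed_orbit (complex_field P Q) c p" "range c = complex_of_pair ` \<Gamma>"
proof -
  obtain \<gamma> T where \<gamma>: "\<And>t. (\<gamma> has_vector_derivative (P (\<gamma> t), Q (\<gamma> t))) (at t)" "T > 0"
    "\<And>t. \<gamma> (t + T) = \<gamma> t" "\<exists>t. \<gamma> t \<noteq> \<gamma> 0" "\<Gamma> = range \<gamma>"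
    using assms unfolding periodic_orbit_def is_solution_def by blast
  have "closed_orbit (complex_field P Q) (\<lambda>t. complex_of_pair (\<gamma> t)) T"
    unfolding closed_orbit_def complex_field_of_pair
    using \<gamma>(2-4) bounded_linear.has_vector_derivative[OF bounded_linear_complex_of_pair \<gamma>(1)]
    by (metis pair_complex_inverse(1))
  then show ?thesis
    using that \<gamma>(5) by (simp add: image_image)
qed

lemma closed_orbit_imp_periodic_orbit:
  assumes "closed_orbit (complex_field P Q) c p"
  shows "periodic_orbit P Q (pair_of_complex ` range c)"
proof -
  note c = closed_orbitD[OF assms]
  have "is_solution P Q (\<lambda>t. pair_of_complex (c t))"
    using bounded_linear.has_vector_derivative[OF bounded_linear_pair_of_complex c(2)]
    by (simp add: is_solution_def pair_of_complex_field)
  moreover have "\<exists>t. pair_of_complex (c t) \<noteq> pair_of_complex (c 0)"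
    using c(4) by (metis pair_complex_inverse(2))
  ultimately show ?thesis
    unfolding periodic_orbit_def using c(1,3)
    by (intro exI[of _ "\<lambda>t. pair_of_complex (c t)"] exI[of _ p]) (simp add: image_image)
qed

lemma limit_cycle_imp_isolated_closed_orbit:
  assumes "limit_cycle P Q \<Gamma>"
  obtains c p U where "closed_orbit (complex_field P Q) c p" "\<Gamma> = pair_of_complex ` range c"
    "open U" "range c \<subseteq> U"
    "\<And>d q. closed_orbit (complex_field P Q) d q \<Longrightarrow> range d \<subseteq> U \<Longrightarrow> range d = range c"
proof -
  obtain V where V: "periodic_orbit P Q \<Gamma>" "open V" "\<Gamma> \<subseteq> V"
    "\<And>\<Gamma>'. periodic_orbit P Q \<Gamma>' \<Longrightarrow> \<Gamma>' \<subseteq> V \<Longrightarrow> \<Gamma>' = \<Gamma>"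
    using assms unfolding limit_cycle_def by blast
  obtain c p where c: "closed_orbit (complex_field P Q) c p" "range c = complex_of_pair ` \<Gamma>"
    by (rule periodic_orbit_imp_closed_orbit[OF V(1)])
  have \<Gamma>: "\<Gamma> = pair_of_complex ` range c"
    unfolding c(2) by (simp add: image_image)
  show ?thesis
  proof (rule that[OF c(1) \<Gamma>])
    show "open (pair_of_complex -` V)"
      using V(2) linear_continuous_on[OF bounded_linear_pair_of_complex]
      by (rule open_vimage)
    show "range c \<subseteq> pair_of_complex -` V"
      using V(3) unfolding \<Gamma> by auto
    fix d q
    assume d: "closed_orbit (complex_field P Q) d q" "range d \<subseteq> pair_of_complex -` V"
    have "pair_of_complex ` range d = \<Gamma>"
      using d(2) by (intro V(4) closed_orbit_imp_periodic_orbit[OF d(1)]) auto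
    then have "complex_of_pair ` pair_of_complex ` range d = range c"
      by (simp only: c(2))
    then show "range d = range c" by (simp add: image_image)
  qed
qed

lemma theta_dot_complex_field:
  "Im (complex_field P Q (complex_of_pair z) / complex_of_pair z) = theta_dot P Q z"
  unfolding complex_field_of_pair by (simp add: complex_of_pair_def theta_dot_def Im_divide algebra_simps)

lemma parallel_not_lin_indep2:
  assumes "Im (cnj (complex_of_pair x) * complex_of_pair y) = 0" "x \<noteq> 0"
  shows "\<not> lin_indep2 y x"
proof -
  obtain a b c d where xy: "x = (a, b)" "y = (c, d)" by (cases x, cases y)
  have par: "a * d = b * c"
    using assms(1) by (simp add: complex_of_pair_def xy)
  \<comment> \<open>For parallel vectors, |x|^2 y equals the inner product of x and y times x; the
    coefficient of y is nonzero.\<close>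
  have "(a\<^sup>2 + b\<^sup>2) *\<^sub>R y + (- (a * c + b * d)) *\<^sub>R x = 0"
    using par by (simp add: xy zero_prod_def power2_eq_square algebra_simps)
  moreover have "a\<^sup>2 + b\<^sup>2 \<noteq> 0"
    using assms(2) by (simp add: xy zero_prod_def sum_power2_eq_zero_iff)
  ultimately show ?thesis unfolding lin_indep2_def by blast
qed

section \<open>Intervals with extended real end points\<close>

lemma convex_ereal_interval: "convex {s. a < ereal s \<and> ereal s < b}"
proof -
  have "is_interval {s. a < ereal s \<and> ereal s < b}"
    unfolding is_interval_1 by (metis (mono_tags, lifting) ereal_less_eq(3) le_less_trans less_le_trans mem_Collect_eq)
  then show ?thesis by (rule is_interval_convex)
qed

text \<open>Turns a limit at a finite or infinite end point into an actual parameter inside the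
  interval.\<close>

lemma eventually_left_end:
  assumes "a < b"
  shows "eventually (\<lambda>s. a < ereal s \<and> ereal s < b) (left_end a)" "left_end a \<noteq> bot"
proof -
  show "eventually (\<lambda>s. a < ereal s \<and> ereal s < b) (left_end a)"
  proof (cases a)
    case (real r)
    have "eventually (\<lambda>s. r < s \<and> ereal s < b) (at_right r)"
    proof (cases b)
      case (real q)
      with assms \<open>a = ereal r\<close> have "r < q" by simp
      then show ?thesis unfolding real by (auto simp: eventually_at_right)
    qed (use assms in \<open>auto simp: eventually_at_filter\<close>)
    with real show ?thesis by (simp add: left_end_def)
  next
    case MInf
    then show ?thesis
      using assms by (cases b) (auto simp: left_end_def)
  qed (use assms in auto)
  show "left_end a \<noteq> bot" by (simp add: left_end_def)
qed

lemma eventually_right_end: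
  assumes "a < b"
  shows "eventually (\<lambda>s. a < ereal s \<and> ereal s < b) (right_end b)" "right_end b \<noteq> bot"
proof -
  show "eventually (\<lambda>s. a < ereal s \<and> ereal s < b) (right_end b)"
  proof (cases b)
    case (real r)
    have "eventually (\<lambda>s. s < r \<and> a < ereal s) (at_left r)"
    proof (cases a)
      case (real q)
      with assms \<open>b = ereal r\<close> have "q < r" by simp
      then show ?thesis unfolding real by (auto simp: eventually_at_left)
    qed (use assms in \<open>auto simp: eventually_at_filter\<close>)
    with real show ?thesis by (simp add: right_end_def conj_commute)
  next
    case PInf
    then show ?thesis
      using assms by (cases a) (auto simp: right_end_def)
  qed (use assms in auto)
  show "right_end b \<noteq> bot" by (simp add: right_end_def)
qed

text \<open>Condition (1) is stated for \<tau> \<noteq> 1, since for \<tau> = 1 the two vectors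
  coincide. Extended real end points cover half-lines and the whole line in condition (2).\<close>

theorem theorem6:
  fixes P Q :: "real \<times> real \<Rightarrow> real"
  assumes C1P: "C1_plane P" and C1Q: "C1_plane Q"
    and equil: "\<And>z. P z = 0 \<and> Q z = 0 \<longleftrightarrow> z = (0, 0)"
    and alpha_nonneg: "\<And>z. alpha P Q z \<ge> 0"
    and cond: "(\<forall>z \<tau>. z \<noteq> (0, 0) \<and> \<tau> > 0 \<and> \<tau> \<noteq> 1 \<longrightarrow>
                   lin_indep2 (P (\<tau> *\<^sub>R z), Q (\<tau> *\<^sub>R z)) (P z, Q z))
             \<or> (\<exists>(a::ereal) b (\<eta>::real \<Rightarrow> real \<times> real).
                   a < b \<and>
                   \<eta> C1_differentiable_on {s. a < ereal s \<and> ereal s < b} \<and>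
                   inj_on \<eta> {s. a < ereal s \<and> ereal s < b} \<and>
                   ((\<lambda>s. norm (\<eta> s)) \<longlongrightarrow> 0) (left_end a) \<and>
                   filterlim (\<lambda>s. norm (\<eta> s)) at_top (right_end b) \<and>
                   ((\<forall>s. a < ereal s \<and> ereal s < b \<longrightarrow> theta_dot P Q (\<eta> s) > 0) \<or>
                    (\<forall>s. a < ereal s \<and> ereal s < b \<longrightarrow> theta_dot P Q (\<eta> s) < 0)))"
  shows "\<forall>\<Gamma>1 \<Gamma>2. limit_cycle P Q \<Gamma>1 \<and> limit_cycle P Q \<Gamma>2 \<longrightarrow> \<Gamma>1 = \<Gamma>2"
proof (intro allI impI)
  fix \<Gamma>1 \<Gamma>2
  assume "limit_cycle P Q \<Gamma>1 \<and> limit_cycle P Q \<Gamma>2"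
  then have lc: "limit_cycle P Q \<Gamma>1" "limit_cycle P Q \<Gamma>2" by auto
  have field: "radially_turning_field (complex_field P Q) (complex_field_deriv P Q)"
    by (rule radially_turning_complex_field[OF C1P C1Q equil alpha_nonneg])
  obtain c p U where c: "closed_orbit (complex_field P Q) c p" "\<Gamma>1 = pair_of_complex ` range c"
    and U: "open U" "range c \<subseteq> U"
    "\<And>e r. closed_orbit (complex_field P Q) e r \<Longrightarrow> range e \<subseteq> U \<Longrightarrow> range e = range c"
    by (rule limit_cycle_imp_isolated_closed_orbit[OF lc(1)]) (rule that; assumption)
  obtain d q V where d: "closed_orbit (complex_field P Q) d q" "\<Gamma>2 = pair_of_complex ` range d"
    and V: "open V" "range d \<subseteq> V"
    "\<And>e r. closed_orbit (complex_field P Q) e r \<Longrightarrow> range e \<subseteq> V \<Longrightarrow> range e = range d"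
    by (rule limit_cycle_imp_isolated_closed_orbit[OF lc(2)]) (rule that; assumption)
  from cond have "range c = range d"
  proof (rule disjE, goal_cases)
    case indep: 1
    show ?thesis
    proof (rule ccontr)
      assume "range c \<noteq> range d"
      then obtain w \<tau> where w: "w \<noteq> 0" "\<tau> > 0" "\<tau> \<noteq> 1"
        and par: "Im (cnj (complex_field P Q w) * complex_field P Q (of_real \<tau> * w)) = 0"
        by (rule radially_turning_field.distinct_closed_orbits_parallel[OF field c(1) d(1)])
      define z where "z = pair_of_complex w"
      have wz: "w = complex_of_pair z" "of_real \<tau> * w = complex_of_pair (\<tau> *\<^sub>R z)"
        by (simp_all add: z_def complex_of_pair_def pair_of_complex_def complex_eq_iff)
      have "z \<noteq> (0, 0)"
        using w(1) by (auto simp: wz(1) complex_of_pair_def complex_eq_iff)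
      moreover from this have "(P z, Q z) \<noteq> 0"
        using equil[of z] by (simp add: zero_prod_def)
      moreover have "Im (cnj (complex_of_pair (P z, Q z)) * complex_of_pair (P (\<tau> *\<^sub>R z), Q (\<tau> *\<^sub>R z))) = 0"
        using par unfolding wz(2) unfolding wz(1) complex_field_of_pair .
      ultimately have "\<not> lin_indep2 (P (\<tau> *\<^sub>R z), Q (\<tau> *\<^sub>R z)) (P z, Q z)"
        by (intro parallel_not_lin_indep2)
      with indep \<open>z \<noteq> (0, 0)\<close> w(2,3) show False by blast
    qed
  next
    case 2
    then obtain a b :: ereal and \<eta> :: "real \<Rightarrow> real \<times> real"
      where ab: "a < b" and C1: "\<eta> C1_differentiable_on {s. a < ereal s \<and> ereal s < b}"
      and lim0: "((\<lambda>s. norm (\<eta> s)) \<longlongrightarrow> 0) (left_end a)"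
      and lim_top: "filterlim (\<lambda>s. norm (\<eta> s)) at_top (right_end b)"
      and sgn: "(\<forall>s. a < ereal s \<and> ereal s < b \<longrightarrow> theta_dot P Q (\<eta> s) > 0) \<or>
                (\<forall>s. a < ereal s \<and> ereal s < b \<longrightarrow> theta_dot P Q (\<eta> s) < 0)"
      by (elim exE conjE) (rule that; assumption)
    let ?I = "{s. a < ereal s \<and> ereal s < b}"
    define h where "h s = complex_of_pair (\<eta> s)" for s
    have norm_h: "norm (h s) = norm (\<eta> s)" for s
      by (simp add: h_def norm_complex_of_pair)
    show ?thesis
    proof (rule isolated_closed_orbit_unique_signed[OF field c(1) d(1) U V convex_ereal_interval])
      show "continuous_on ?I h"
        unfolding h_def
        using C1_differentiable_imp_continuous_on[OF C1]
        by (rule bounded_linear.continuous_on[OF bounded_linear_complex_of_pair])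
      show "(\<forall>s\<in>?I. Im (complex_field P Q (h s) / h s) > 0) \<or> (\<forall>s\<in>?I. Im (complex_field P Q (h s) / h s) < 0)"
        using sgn by (simp add: h_def theta_dot_complex_field)
      show "\<exists>s\<in>?I. norm (h s) < e" if "e > 0" for e
        using eventually_happens'[OF eventually_left_end(2) eventually_conj[OF
            eventually_left_end(1)[OF ab] order_tendstoD(2)[OF lim0 that]]] ab
        by (auto simp: norm_h)
      show "\<exists>s\<in>?I. norm (h s) > R" for R
        using eventually_happens'[OF eventually_right_end(2) eventually_conj[OF
            eventually_right_end(1)[OF ab] filterlim_at_top_dense[THEN iffD1, OF lim_top, rule_format]]] ab
        by (auto simp: norm_h)
    qed
  qed
  then show "\<Gamma>1 = \<Gamma>2" using c(2) d(2) by simp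
qed

end
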